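(* Assume $T=\bigcup_{k=1}^L T_k\subseteq\mathbb{R}^n$ is a compact semialgebraic set with $$T_k=\{x\in\mathbb{R}^n:\ f^k_1(x)\ge 0,\dots,f^k_{m_k}(x)\ge 0\}$$ defined by polynomials $f^k_i$. If for each $u\in\partial_cT$ and each $f^k_i$ for which $f^k_i(u)=0$, the set $T_k$ has interior near $u$ and $f^k_i$ is either sos-concave or strictly quasi-concave at $u$, then $\mathrm{conv}(T)$ is SDP representable.
   Context: For a set $T\subseteq\mathbb{R}^n$, the convex boundary is $\partial_cT=\{u\in T:\ \ell^Tu=\min_{x\in T}\ell^Tx\text{ for some }\ell\in\mathbb{R}^n\text{ with }\|\ell\|=1\}$; $\mathrm{conv}$ is the convex hull. The set $T_k$ has interior near $u$ if for every sufficiently small $\delta>0$ there exists $v$ with $\|v-u\|<\delta$ and $f^k_i(v)>0$ for all $i=1,\dots,m_k$. A set $S\subseteq\mathbb{R}^n$ is SDP representable if there are $N\ge 0$ and real symmetric matrices $A_0,A_1,\dots,A_n,B_1,\dots,B_N$ of a common size such that $S=\{x\in\mathbb{R}^n:\exists u\in\mathbb{R}^N,\ A_0+\sum_{i=1}^n x_iA_i+\sum_{j=1}^N u_jB_j\succeq 0\}$, where $\succeq 0$ means positive semidefinite. A polynomial $g$ is sos-concave if $-\nabla^2 g(x)=W(x)^TW(x)$ for some (possibly nonsquare) matrix polynomial $W(x)$. A smooth function $f$ is strictly quasi-concave at $u$ if $-v^T\nabla^2 f(u)v>0$ for all $0\ne v\in\mathbb{R}^n$ with $\nabla f(u)^Tv=0$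 (in particular, if $\nabla f(u)=0$, this requires $-\nabla^2 f(u)$ to be positive definite). *)

theory Defs
  imports "Jordan_Normal_Form.Matrix" "HOL-Analysis.Analysis"
begin

text \<open>
  Points of $\mathbb{R}^n$ have type \<open>real ^ 'n\<close>. Matrices whose size is existentially quantified
  have type \<open>real mat\<close> (with \<open>carrier_mat\<close>). The infix \<open>$\<close> and \<open>\<bullet>\<close> are reserved for the former.
\<close>

no_notation vec_index (infixl \<open>$\<close> 100)
no_notation scalar_prod (infix \<open>\<bullet>\<close> 70)

definition gradient :: "(real ^ 'n \<Rightarrow> real) \<Rightarrow> real ^ 'n \<Rightarrow> real ^ 'n" where
  "gradient f x = (\<chi> i. frechet_derivative f (at x) (axis i 1))"

definition hessian :: "(real ^ 'n \<Rightarrow> real) \<Rightarrow> real ^ 'n \<Rightarrow> real ^ 'n ^ 'n" where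
  "hessian f x = jacobian (gradient f) (at x)"

definition convex_boundary :: "(real ^ 'n) set \<Rightarrow> (real ^ 'n) set" where
  "convex_boundary T = {u \<in> T. \<exists>l. norm l = 1 \<and> (\<forall>x\<in>T. l \<bullet> u \<le> l \<bullet> x)}"

definition basic_set :: "nat \<Rightarrow> (nat \<Rightarrow> real ^ 'n \<Rightarrow> real) \<Rightarrow> (real ^ 'n) set" where
  "basic_set m g = {x. \<forall>i\<in>{1..m}. 0 \<le> g i x}"

text \<open>
  This depends on the chosen inequalities \<open>g 1, \<dots>, g m\<close>, not only on the set they define.
\<close>

definition has_interior_near :: "nat \<Rightarrow> (nat \<Rightarrow> real ^ 'n \<Rightarrow> real) \<Rightarrow> real ^ 'n \<Rightarrow> bool" where
  "has_interior_near m g u \<longleftrightarrow>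
     (\<forall>\<^sub>F \<delta> in at_right 0. \<exists>v. norm (v - u) < \<delta> \<and> (\<forall>i\<in>{1..m}. 0 < g i v))"

text \<open>
  \<open>W l i\<close> is the entry in row \<open>l < r\<close> and column \<open>i\<close> of an $r \times n$ matrix polynomial; the last
  conjunct is $-\nabla^2 g(x) = W(x)^T W(x)$, entry by entry.
\<close>

definition sos_concave :: "(real ^ 'n \<Rightarrow> real) \<Rightarrow> bool" where
  "sos_concave g \<longleftrightarrow> real_polynomial_function g \<and>
     (\<exists>(r::nat) (W :: nat \<Rightarrow> 'n \<Rightarrow> real ^ 'n \<Rightarrow> real).
        (\<forall>l<r. \<forall>i. real_polynomial_function (W l i)) \<and>
        (\<forall>x. - hessian g x = (\<chi> i j. \<Sum>l<r. W l i x * W l j x)))"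

definition strictly_quasi_concave_at :: "(real ^ 'n \<Rightarrow> real) \<Rightarrow> real ^ 'n \<Rightarrow> bool" where
  "strictly_quasi_concave_at f u \<longleftrightarrow>
     (\<forall>v. v \<noteq> 0 \<and> gradient f u \<bullet> v = 0 \<longrightarrow> 0 < - (v \<bullet> (hessian f u *v v)))"

definition symmetric_mat :: "nat \<Rightarrow> real mat \<Rightarrow> bool" where
  "symmetric_mat d M \<longleftrightarrow> M \<in> carrier_mat d d \<and> transpose_mat M = M"

definition psd_mat :: "nat \<Rightarrow> real mat \<Rightarrow> bool" where
  "psd_mat d M \<longleftrightarrow> symmetric_mat d M \<and> (\<forall>z\<in>carrier_vec d. 0 \<le> scalar_prod z (M *\<^sub>v z))"

text \<open>
  The linear matrix pencil $A_0 + \sum_i x_i A_i + \sum_{j<N} u_j B_j$, written entrywise because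
  \<open>real mat\<close> is not an instance of \<open>comm_monoid_add\<close>. Lifting variables are indexed from 0.
\<close>

definition lmi_pencil ::
  "nat \<Rightarrow> real mat \<Rightarrow> ('n::finite \<Rightarrow> real mat) \<Rightarrow> nat \<Rightarrow> (nat \<Rightarrow> real mat) \<Rightarrow>
   real ^ 'n \<Rightarrow> real Matrix.vec \<Rightarrow> real mat" where
  "lmi_pencil d A0 A N B x u = Matrix.mat d d (\<lambda>(a, b).
     A0 $$ (a, b) + (\<Sum>i\<in>UNIV. x $ i * A i $$ (a, b)) + (\<Sum>j<N. vec_index u j * B j $$ (a, b)))"

definition sdp_representable :: "(real ^ 'n) set \<Rightarrow> bool" where
  "sdp_representable S \<longleftrightarrow>
     (\<exists>(N::nat) (d::nat) A0 A B.
        symmetric_mat d A0 \<and> (\<forall>i. symmetric_mat d (A i)) \<and> (\<forall>j<N. symmetric_mat d (B j)) \<and>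
        S = {x. \<exists>u\<in>carrier_vec N. psd_mat d (lmi_pencil d A0 A N B x u)})"

end

theory Submission
  imports Defs
begin

text \<open>
  A linear functional on polynomials of bounded degree is a combination \<open>p \<mapsto> \<Sum>x\<in>X. c x * p x\<close> of
  finitely many evaluations, so it can be parametrized by the weights \<open>c\<close>, and nonnegativity on
  squares and on ball-weighted squares is a linear matrix inequality in \<open>c\<close>. If $-\nabla^2 g$ is a sum
  of squares plus $(d^2 - |x - u|^2)$ times a sum of squares, then Taylor's formula along the segments
  from the barycentre gives Jensen's inequality $L(g) \le g(\mathrm{bary}\,L)$ for such functionals, so
  their barycentres with $L(g) \ge 0$ form exactly the part of \<open>{g \<ge> 0}\<close> in the ball. An sos-concave
  polynomial has such a certificate. If $f$ is strictly quasi-concave at a zero $u$, then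
  $g = f - c f^2$ has negative definite Hessian at $u$ for large $c$ and the same sign as $f$ near $u$,
  and on a small ball the certificate comes from \<open>\<epsilon> \<plusminus> (p - p(u))\<close> lying in the quadratic module of the
  ball for every polynomial \<open>p\<close>. By Krein--Milman, conv T is the hull of its compact convex boundary,
  which is covered by finitely many such cells; the hull of the cells is represented by a family of
  functionals with total mass one, a functional of mass zero having first moments zero.
\<close>

section \<open>Linear matrix inequalities\<close>

text \<open>For a moment relaxation to represent a cell exactly, Jensen's inequality must hold for
  pseudo-moments. This requires an algebraic certificate of concavity; concavity as an inequality is
  not enough. Localization supplies one cheaply: the radius may shrink with the tolerance
  \<epsilon>, so a closure argument that starts from the coordinates and passes through sums and
  products replaces a Positivstellensatz on a fixed ball. Taylor's formula evaluates the Hessian at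
  the moved points a + s(x - a), whereas a functional controls the ball weight only at x; the
  explicit concavity of d^2 - |x - u|^2 bridges the two. Weights on points are convenient because a
  finite weighted sum can be differentiated termwise along segments, with no bookkeeping of
  coefficients; the weights may have either sign. When hulls of several cells are combined, a block
  of zero mass might contribute a recession direction, and positivity on the squares of 1 + t x_k
  excludes this.\<close>

definition lmi :: "'j set \<Rightarrow> (real ^ 'n \<Rightarrow> ('j \<Rightarrow> real) \<Rightarrow> bool) \<Rightarrow> bool" where
  "lmi J Q \<longleftrightarrow> (\<exists>(d::nat) A0 A B.
     (\<forall>a b. A0 a b = A0 b a) \<and> (\<forall>i a b. A i a b = A i b a) \<and> (\<forall>j a b. B j a b = B j b a) \<and>
     (\<forall>x u. Q x u \<longleftrightarrow> (\<forall>z::nat \<Rightarrow> real. 0 \<le> (\<Sum>a<d. \<Sum>b<d. z a * z b *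
        (A0 a b + (\<Sum>i\<in>UNIV. x $ i * A i a b) + (\<Sum>j\<in>J. u j * B j a b))))))"

text \<open>\<open>lmi\<close> uses quadratic forms over {..<d}. Direct sums and monomial words
  bring their own index types, so the enumeration of a finite index set is done here once.\<close>

lemma lmiI:
  fixes C :: "'i \<Rightarrow> 'i \<Rightarrow> real" and A :: "'n::finite \<Rightarrow> 'i \<Rightarrow> 'i \<Rightarrow> real"
    and B :: "'j \<Rightarrow> 'i \<Rightarrow> 'i \<Rightarrow> real"
  assumes I: "finite I"
    and s0: "\<And>a b. C a b = C b a" and sA: "\<And>i a b. A i a b = A i b a"
    and sB: "\<And>j a b. B j a b = B j b a"
    and Q: "\<And>x u. Q x u \<longleftrightarrow> (\<forall>z. 0 \<le> (\<Sum>a\<in>I. \<Sum>b\<in>I. z a * z b *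
        (C a b + (\<Sum>i\<in>UNIV. x $ i * A i a b) + (\<Sum>j\<in>J. u j * B j a b))))"
  shows "lmi J Q"
proof -
  define d where "d = card I"
  obtain h where h: "bij_betw h {..<d} I"
    using ex_bij_betw_nat_finite[OF I] by (auto simp: d_def atLeast0LessThan)
  have r: "(\<Sum>a<d. \<Sum>b<d. G (h a) (h b)) = (\<Sum>a\<in>I. \<Sum>b\<in>I. G a b)" for G :: "'i \<Rightarrow> 'i \<Rightarrow> real"
  proof -
    have "(\<Sum>a<d. \<Sum>b<d. G (h a) (h b)) = (\<Sum>a<d. \<Sum>b\<in>I. G (h a) b)"
      by (intro sum.cong refl sum.reindex_bij_betw[OF h])
    also have "\<dots> = (\<Sum>a\<in>I. \<Sum>b\<in>I. G a b)"
      by (rule sum.reindex_bij_betw[OF h])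
    finally show ?thesis .
  qed
  let ?g = "inv_into {..<d} h"
  have gh: "?g (h a) = a" if "a < d" for a
    using h that by (simp add: bij_betw_inv_into_left)
  let ?M = "\<lambda>x u a b. C a b + (\<Sum>i\<in>UNIV. x $ i * A i a b) + (\<Sum>j\<in>J. u j * B j a b)"
  have "Q x u \<longleftrightarrow> (\<forall>z. 0 \<le> (\<Sum>a<d. \<Sum>b<d. z a * z b * ?M x u (h a) (h b)))" for x u
  proof
    assume q: "Q x u"
    show "\<forall>z. 0 \<le> (\<Sum>a<d. \<Sum>b<d. z a * z b * ?M x u (h a) (h b))"
    proof
      fix z
      have "(\<Sum>a<d. \<Sum>b<d. z a * z b * ?M x u (h a) (h b))
          = (\<Sum>a<d. \<Sum>b<d. z (?g (h a)) * z (?g (h b)) * ?M x u (h a) (h b))"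
        by (intro sum.cong refl) (simp add: gh)
      also have "\<dots> = (\<Sum>a\<in>I. \<Sum>b\<in>I. z (?g a) * z (?g b) * ?M x u a b)"
        by (rule r)
      also have "\<dots> \<ge> 0"
        using q[unfolded Q, rule_format, of "\<lambda>a. z (?g a)"] .
      finally show "0 \<le> (\<Sum>a<d. \<Sum>b<d. z a * z b * ?M x u (h a) (h b))" .
    qed
  next
    assume q: "\<forall>z. 0 \<le> (\<Sum>a<d. \<Sum>b<d. z a * z b * ?M x u (h a) (h b))"
    show "Q x u" unfolding Q
    proof
      fix z
      show "0 \<le> (\<Sum>a\<in>I. \<Sum>b\<in>I. z a * z b * ?M x u a b)"
        using q[rule_format, of "\<lambda>a. z (h a)"] by (simp only: r[of "\<lambda>a b. z a * z b * ?M x u a b"])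
    qed
  qed
  then show ?thesis
    unfolding lmi_def
    by (intro exI[of _ d] exI[of _ "\<lambda>a b. C (h a) (h b)"] exI[of _ "\<lambda>i a b. A i (h a) (h b)"]
        exI[of _ "\<lambda>j a b. B j (h a) (h b)"] conjI allI s0 sA sB)
qed

lemma lmi_true: "lmi J (\<lambda>x u. True)"
  by (rule lmiI[where I="{}::nat set" and C="\<lambda>_ _. 0" and A="\<lambda>_ _ _. 0" and B="\<lambda>_ _ _. 0"]) auto

text \<open>A block diagonal pencil is positive semidefinite exactly when both blocks are. The sum
  type \<open>nat + nat\<close> indexes the blocks without any offsets.\<close>

lemma lmi_conj:
  fixes Q R :: "real ^ 'n \<Rightarrow> ('j \<Rightarrow> real) \<Rightarrow> bool"
  assumes "lmi J Q" "lmi J R"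
  shows "lmi J (\<lambda>x u. Q x u \<and> R x u)"
proof -
  obtain d A0 A B where
    s: "\<forall>a b. A0 a b = A0 b a" "\<forall>i a b. A i a b = A i b a" "\<forall>j a b. B j a b = B j b a"
    and Q: "\<forall>x u. Q x u \<longleftrightarrow> (\<forall>z::nat \<Rightarrow> real. 0 \<le> (\<Sum>a<d. \<Sum>b<d. z a * z b *
        (A0 a b + (\<Sum>i\<in>UNIV. x $ i * A i a b) + (\<Sum>j\<in>J. u j * B j a b))))"
    using assms(1) unfolding lmi_def by (elim exE conjE) (rule that)
  note s = s[rule_format] and Q = Q[rule_format]
  obtain d' A0' A' B' where
    s': "\<forall>a b. A0' a b = A0' b a" "\<forall>i a b. A' i a b = A' i b a" "\<forall>j a b. B' j a b = B' j b a"
    and R: "\<forall>x u. R x u \<longleftrightarrow> (\<forall>z::nat \<Rightarrow> real. 0 \<le> (\<Sum>a<d'. \<Sum>b<d'. z a * z b *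
        (A0' a b + (\<Sum>i\<in>UNIV. x $ i * A' i a b) + (\<Sum>j\<in>J. u j * B' j a b))))"
    using assms(2) unfolding lmi_def by (elim exE conjE) (rule that)
  note s' = s'[rule_format] and R = R[rule_format]
  define D :: "(nat \<Rightarrow> nat \<Rightarrow> real) \<Rightarrow> (nat \<Rightarrow> nat \<Rightarrow> real) \<Rightarrow> nat + nat \<Rightarrow> nat + nat \<Rightarrow> real"
    where "D F G a b = (case a of Inl a \<Rightarrow> (case b of Inl b \<Rightarrow> F a b | Inr b \<Rightarrow> 0)
                               | Inr a \<Rightarrow> (case b of Inl b \<Rightarrow> 0 | Inr b \<Rightarrow> G a b))" for F G a b
  have D: "D F G (Inl a) (Inl b) = F a b" "D F G (Inr a) (Inr b') = G a b'"
      "D F G (Inl a) (Inr b) = 0" "D F G (Inr a) (Inl b) = 0" for F G a b b'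
    by (simp_all add: D_def)
  have Ds: "D F G a b = D F G b a" if "\<And>a b. F a b = F b a" "\<And>a b. G a b = G b a" for F G a b
    using that by (cases a; cases b) (auto simp: D_def)
  let ?q = "\<lambda>x u z. \<Sum>a<d. \<Sum>b<d. z a * z b *
        (A0 a b + (\<Sum>i\<in>UNIV. x $ i * A i a b) + (\<Sum>j\<in>J. u j * B j a b))"
  let ?q' = "\<lambda>x u z. \<Sum>a<d'. \<Sum>b<d'. z a * z b *
        (A0' a b + (\<Sum>i\<in>UNIV. x $ i * A' i a b) + (\<Sum>j\<in>J. u j * B' j a b))"
  have split: "(\<Sum>a\<in>{..<d} <+> {..<d'}. \<Sum>b\<in>{..<d} <+> {..<d'}. z a * z b *
        (D A0 A0' a b + (\<Sum>i\<in>UNIV. x $ i * D (A i) (A' i) a b) + (\<Sum>j\<in>J. u j * D (B j) (B' j) a b)))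
      = ?q x u (\<lambda>a. z (Inl a)) + ?q' x u (\<lambda>a. z (Inr a))" for x :: "real^'n" and u z
    by (simp add: sum.Plus D sum.distrib)
  have "Q x u \<and> R x u \<longleftrightarrow> (\<forall>z. 0 \<le> ?q x u (\<lambda>a. z (Inl a)) + ?q' x u (\<lambda>a. z (Inr a :: nat + nat)))" for x u
  proof
    assume "Q x u \<and> R x u"
    then show "\<forall>z. 0 \<le> ?q x u (\<lambda>a. z (Inl a)) + ?q' x u (\<lambda>a. z (Inr a :: nat + nat))"
      unfolding Q R by (intro allI add_nonneg_nonneg) (elim conjE allE, assumption)+
  next
    assume a: "\<forall>z. 0 \<le> ?q x u (\<lambda>a. z (Inl a)) + ?q' x u (\<lambda>a. z (Inr a :: nat + nat))"
    show "Q x u \<and> R x u"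
    proof
      show "Q x u" unfolding Q
      proof
        fix z :: "nat \<Rightarrow> real"
        \<comment> \<open>A test vector supported on one block isolates the form of that
          block.\<close>
        show "0 \<le> ?q x u z" using a[rule_format, of "case_sum z (\<lambda>_. 0)"] by simp
      qed
      show "R x u" unfolding R
      proof
        fix z :: "nat \<Rightarrow> real"
        show "0 \<le> ?q' x u z" using a[rule_format, of "case_sum (\<lambda>_. 0) z"] by simp
      qed
    qed
  qed
  then show ?thesis
    by (intro lmiI[where I="{..<d} <+> {..<d'}" and C="D A0 A0'" and A="\<lambda>i. D (A i) (A' i)"
          and B="\<lambda>j. D (B j) (B' j)"] Ds s s') (simp_all only: split finite_Plus finite_lessThan)
qed

lemma lmi_ball:
  assumes "finite K" "\<And>k. k \<in> K \<Longrightarrow> lmi J (Q k)"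
  shows "lmi J (\<lambda>x u. \<forall>k\<in>K. Q k x u)"
  using assms
proof (induction K rule: finite_induct)
  case empty
  then show ?case using lmi_true by simp
next
  case (insert k K)
  then have "lmi J (\<lambda>x u. Q k x u \<and> (\<forall>k\<in>K. Q k x u))"
    by (intro lmi_conj) auto
  then show ?case by simp
qed

lemma lmi_affine: "lmi J (\<lambda>(x::real^'n) u. 0 \<le> \<alpha> + (\<Sum>i\<in>UNIV. x $ i * \<beta> i) + (\<Sum>j\<in>J. u j * \<gamma> j))"
proof (rule lmiI[where I="{()}" and C="\<lambda>_ _. \<alpha>" and A="\<lambda>i _ _. \<beta> i" and B="\<lambda>j _ _. \<gamma> j"])
  fix x :: "real^'n" and u
  let ?e = "\<alpha> + (\<Sum>i\<in>UNIV. x $ i * \<beta> i) + (\<Sum>j\<in>J. u j * \<gamma> j)"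
  have "(0 \<le> e) = (\<forall>z::unit\<Rightarrow>real. 0 \<le> z () * z () * e)" for e :: real
  proof
    assume "\<forall>z::unit\<Rightarrow>real. 0 \<le> z () * z () * e"
    from this[rule_format, of "\<lambda>_. 1"] show "0 \<le> e" by simp
  qed simp
  from this[of ?e] show "(0 \<le> ?e) = (\<forall>z. 0 \<le> (\<Sum>a\<in>{()}. \<Sum>b\<in>{()}. z a * z b * ?e))"
    by simp
qed auto

lemma lmi_affine_eq: "lmi J (\<lambda>(x::real^'n) u. \<alpha> + (\<Sum>i\<in>UNIV. x $ i * \<beta> i) + (\<Sum>j\<in>J. u j * \<gamma> j) = 0)"
proof -
  have "lmi J (\<lambda>x u. 0 \<le> \<alpha> + (\<Sum>i\<in>UNIV. x $ i * \<beta> i) + (\<Sum>j\<in>J. u j * \<gamma> j)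
      \<and> 0 \<le> (-\<alpha>) + (\<Sum>i\<in>UNIV. x $ i * (-\<beta> i)) + (\<Sum>j\<in>J. u j * (-\<gamma> j)))"
    by (intro lmi_conj lmi_affine)
  moreover have "(0 \<le> \<alpha> + (\<Sum>i\<in>UNIV. x $ i * \<beta> i) + (\<Sum>j\<in>J. u j * \<gamma> j)
      \<and> 0 \<le> (-\<alpha>) + (\<Sum>i\<in>UNIV. x $ i * (-\<beta> i)) + (\<Sum>j\<in>J. u j * (-\<gamma> j)))
    \<longleftrightarrow> \<alpha> + (\<Sum>i\<in>UNIV. x $ i * \<beta> i) + (\<Sum>j\<in>J. u j * \<gamma> j) = 0" for x :: "real^'n" and u
    by (simp add: sum_negf) linarith
  ultimately show ?thesis by simp
qed

lemma lmi_psd: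
  fixes B :: "'j \<Rightarrow> 'i \<Rightarrow> 'i \<Rightarrow> real"
  assumes "finite I" "\<And>j a b. B j a b = B j b a"
  shows "lmi J (\<lambda>(x::real^'n) u. \<forall>z. 0 \<le> (\<Sum>a\<in>I. \<Sum>b\<in>I. z a * z b * (\<Sum>j\<in>J. u j * B j a b)))"
  by (rule lmiI[where I=I and C="\<lambda>_ _. 0" and A="\<lambda>_ _ _. 0" and B=B]) (use assms in auto)

text \<open>This is the localizing matrix condition: expanding the square gives the quadratic form,
  in \<open>z\<close>, of the matrix with entries \<Sum>j u_j w_j p_a(j) p_b(j), which is symmetric
  and linear in \<open>u\<close>.\<close>

lemma lmi_weighted_squares:
  assumes "finite I" "finite J"
  shows "lmi J (\<lambda>(x::real^'n) u. \<forall>z. 0 \<le> (\<Sum>j\<in>J. u j * w j * (\<Sum>a\<in>I. z a * p a j)\<^sup>2))"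
proof -
  have "(\<Sum>a\<in>I. \<Sum>b\<in>I. z a * z b * (\<Sum>j\<in>J. u j * (w j * p a j * p b j)))
     = (\<Sum>j\<in>J. u j * w j * (\<Sum>a\<in>I. z a * p a j)\<^sup>2)" for z u
  proof -
    have "(\<Sum>a\<in>I. \<Sum>b\<in>I. z a * z b * (\<Sum>j\<in>J. u j * (w j * p a j * p b j)))
       = (\<Sum>a\<in>I. \<Sum>b\<in>I. \<Sum>j\<in>J. u j * w j * ((z a * p a j) * (z b * p b j)))"
      by (simp add: sum_distrib_left mult_ac)
    also have "\<dots> = (\<Sum>j\<in>J. \<Sum>a\<in>I. \<Sum>b\<in>I. u j * w j * ((z a * p a j) * (z b * p b j)))"
    proof -
      have "(\<Sum>a\<in>I. \<Sum>b\<in>I. \<Sum>j\<in>J. u j * w j * ((z a * p a j) * (z b * p b j)))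
        = (\<Sum>a\<in>I. \<Sum>j\<in>J. \<Sum>b\<in>I. u j * w j * ((z a * p a j) * (z b * p b j)))"
        by (intro sum.cong refl sum.swap)
      then show ?thesis by (simp only: sum.swap[of _ J I])
    qed
    also have "\<dots> = (\<Sum>j\<in>J. u j * w j * (\<Sum>a\<in>I. z a * p a j)\<^sup>2)"
      unfolding power2_eq_square sum_product by (simp only: sum_distrib_left)
    finally show ?thesis .
  qed
  then show ?thesis
    using lmi_psd[OF assms(1), of "\<lambda>j a b. w j * p a j * p b j" J] by (simp add: mult_ac)
qed

lemma sdp_representable_if_lmi:
  fixes Q :: "real ^ 'n \<Rightarrow> ('j \<Rightarrow> real) \<Rightarrow> bool"
  assumes J: "finite J" and Q: "lmi J Q"
  shows "sdp_representable {x. \<exists>u. Q x u}"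
proof -
  obtain d A0 A B where
    s: "\<forall>a b. A0 a b = A0 b a" "\<forall>i a b. A i a b = A i b a" "\<forall>j a b. B j a b = B j b a"
    and Q: "\<forall>x u. Q x u \<longleftrightarrow> (\<forall>z::nat \<Rightarrow> real. 0 \<le> (\<Sum>a<d. \<Sum>b<d. z a * z b *
        (A0 a b + (\<Sum>i\<in>UNIV. x $ i * A i a b) + (\<Sum>j\<in>J. u j * B j a b))))"
    using Q unfolding lmi_def by (elim exE conjE) (rule that)
  note s = s[rule_format] and Q = Q[rule_format]
  define N where "N = card J"
  obtain h where h: "bij_betw h {..<N} J"
    using ex_bij_betw_nat_finite[OF J] by (auto simp: N_def atLeast0LessThan)
  let ?g = "inv_into {..<N} h"
  have hg: "h (?g a) = a" if "a \<in> J" for a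
    using h that by (simp add: bij_betw_inv_into_right)
  have gh: "?g (h a) = a" if "a < N" for a
    using h that by (simp add: bij_betw_inv_into_left)
  define MA0 where "MA0 = Matrix.mat d d (\<lambda>(a, b). A0 a b)"
  define MA where "MA i = Matrix.mat d d (\<lambda>(a, b). A i a b)" for i
  define MB where "MB j = Matrix.mat d d (\<lambda>(a, b). B (h j) a b)" for j
  have sym: "symmetric_mat d (Matrix.mat d d (\<lambda>(a, b). F a b))" if "\<And>a b. F a b = F b a"
    for F :: "nat \<Rightarrow> nat \<Rightarrow> real"
    unfolding symmetric_mat_def by (auto simp: that)
  let ?M = "\<lambda>x u a b. A0 a b + (\<Sum>i\<in>UNIV. x $ i * A i a b) + (\<Sum>j\<in>J. u j * B j a b)"
  have pencil: "lmi_pencil d MA0 MA N MB x u = Matrix.mat d d (\<lambda>(a, b). ?M x (\<lambda>j. vec_index u (?g j)) a b)"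
    for x u
  proof (rule eq_matI; simp add: lmi_pencil_def)
    fix a b assume "a < d" "b < d"
    have "(\<Sum>j<N. vec_index u j * MB j $$ (a, b)) = (\<Sum>j<N. vec_index u (?g (h j)) * B (h j) a b)"
      using \<open>a < d\<close> \<open>b < d\<close> by (intro sum.cong refl) (simp add: MB_def gh)
    also have "\<dots> = (\<Sum>j\<in>J. vec_index u (?g j) * B j a b)"
      by (rule sum.reindex_bij_betw[OF h])
    finally show "MA0 $$ (a, b) + (\<Sum>i\<in>UNIV. x $ i * MA i $$ (a, b)) + (\<Sum>j<N. vec_index u j * MB j $$ (a, b))
      = A0 a b + (\<Sum>i\<in>UNIV. x $ i * A i a b) + (\<Sum>j\<in>J. vec_index u (?g j) * B j a b)"
      using \<open>a < d\<close> \<open>b < d\<close> by (simp add: MA0_def MA_def)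
  qed
  have quad: "scalar_prod z (Matrix.mat d d (\<lambda>(a, b). F a b) *\<^sub>v z)
      = (\<Sum>a<d. \<Sum>b<d. vec_index z a * vec_index z b * F a b)" if "z \<in> carrier_vec d"
    for z and F :: "nat \<Rightarrow> nat \<Rightarrow> real"
    using that by (auto simp: scalar_prod_def sum_distrib_left atLeast0LessThan mult_ac intro!: sum.cong)
  have psd: "psd_mat d (lmi_pencil d MA0 MA N MB x u) \<longleftrightarrow> Q x (\<lambda>j. vec_index u (?g j))" for x u
  proof -
    let ?F = "?M x (\<lambda>j. vec_index u (?g j))"
    have "symmetric_mat d (lmi_pencil d MA0 MA N MB x u)"
      unfolding pencil
    proof (rule sym)
      show "?F a b = ?F b a" for a b
        using s(1)[of a b] s(2)[of _ a b] s(3)[of _ a b] by presburger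
    qed
    then have "psd_mat d (lmi_pencil d MA0 MA N MB x u)
        \<longleftrightarrow> (\<forall>z\<in>carrier_vec d. 0 \<le> (\<Sum>a<d. \<Sum>b<d. vec_index z a * vec_index z b * ?F a b))"
      by (simp add: psd_mat_def pencil quad)
    also have "\<dots> \<longleftrightarrow> (\<forall>z. 0 \<le> (\<Sum>a<d. \<Sum>b<d. z a * z b * ?F a b))"
    proof
      assume a: "\<forall>z\<in>carrier_vec d. 0 \<le> (\<Sum>a<d. \<Sum>b<d. vec_index z a * vec_index z b * ?F a b)"
      show "\<forall>z. 0 \<le> (\<Sum>a<d. \<Sum>b<d. z a * z b * ?F a b)"
      proof
        fix z :: "nat \<Rightarrow> real"
        show "0 \<le> (\<Sum>a<d. \<Sum>b<d. z a * z b * ?F a b)"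
          using a[rule_format, of "Matrix.vec d z"] by simp
      qed
    qed blast
    finally show ?thesis unfolding Q .
  qed
  have "{x. \<exists>u. Q x u} = {x. \<exists>u\<in>carrier_vec N. psd_mat d (lmi_pencil d MA0 MA N MB x u)}"
  proof (rule Collect_cong)
    fix x
    show "(\<exists>u. Q x u) = (\<exists>u\<in>carrier_vec N. psd_mat d (lmi_pencil d MA0 MA N MB x u))"
    proof
      assume "\<exists>u. Q x u"
      then obtain u where u: "Q x u" ..
      \<comment> \<open>Only the values of \<open>u\<close> on \<open>J\<close> enter
        \<open>Q\<close>, so tabulating these in a vector of length \<open>N\<close> loses
        nothing.\<close>
      have e: "vec_index (Matrix.vec N (\<lambda>k. u (h k))) (?g j) = u j" if "j \<in> J" for j
        using that h hg[OF that] bij_betw_inv_into[OF h] by (auto simp: bij_betw_def)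
      have "Q x (\<lambda>j. vec_index (Matrix.vec N (\<lambda>k. u (h k))) (?g j))"
        using u unfolding Q by (simp add: e cong: sum.cong)
      then show "\<exists>u\<in>carrier_vec N. psd_mat d (lmi_pencil d MA0 MA N MB x u)"
        by (intro bexI[of _ "Matrix.vec N (\<lambda>k. u (h k))"]) (simp_all only: psd vec_carrier)
    qed (auto simp: psd)
  qed
  moreover have "symmetric_mat d MA0" "\<And>i. symmetric_mat d (MA i)" "\<And>j. symmetric_mat d (MB j)"
    unfolding MA0_def MA_def MB_def by (intro sym s)+
  ultimately show ?thesis
    unfolding sdp_representable_def
    by (intro exI[of _ N] exI[of _ d] exI[of _ MA0] exI[of _ MA] exI[of _ MB] conjI allI impI)
qed

section \<open>Polynomials of bounded degree\<close>

text \<open>\<open>None\<close> is a homogenizing coordinate with constant value 1: words of length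
  exactly N in n + 1 letters then give all monomials of degree at most N in n variables.\<close>

primrec homog_coord :: "'n option \<Rightarrow> real ^ 'n \<Rightarrow> real" where
  "homog_coord None = (\<lambda>x. 1)"
| "homog_coord (Some i) = (\<lambda>x. x $ i)"

primrec monomial :: "'n option list \<Rightarrow> real ^ 'n \<Rightarrow> real" where
  "monomial [] = (\<lambda>x. 1)"
| "monomial (j # js) = (\<lambda>x. homog_coord j x * monomial js x)"

text \<open>Splitting off one homogenized coordinate at a time makes the degree an induction
  parameter and avoids exponents and coefficients.\<close>

primrec poly_le :: "nat \<Rightarrow> (real ^ 'n \<Rightarrow> real) set" where
  "poly_le 0 = range (\<lambda>c x. c)"
| "poly_le (Suc N) = {\<lambda>x. \<Sum>j\<in>UNIV. homog_coord j x * F j x | F. \<forall>j. F j \<in> poly_le N}"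

lemma sum_option: "(\<Sum>j\<in>UNIV. f j) = f None + (\<Sum>i\<in>UNIV. f (Some i))"
  for f :: "'n::finite option \<Rightarrow> real"
  by (simp add: UNIV_option_conv sum.reindex)

lemma poly_le_SucI:
  assumes "\<And>j. F j \<in> poly_le N" "\<And>x. f x = (\<Sum>j\<in>UNIV. homog_coord j x * F j x)"
  shows "f \<in> poly_le (Suc N)"
proof -
  have "f = (\<lambda>x. \<Sum>j\<in>UNIV. homog_coord j x * F j x)"
    using assms(2) by (rule ext)
  then show ?thesis using assms(1) by auto
qed

lemma poly_le_SucE:
  assumes "f \<in> poly_le (Suc N)"
  obtains F where "\<And>j. F j \<in> poly_le N" "\<And>x. f x = (\<Sum>j\<in>UNIV. homog_coord j x * F j x)"
  using assms by auto

declare poly_le.simps(2) [simp del]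

lemma poly_le_scale: "f \<in> poly_le N \<Longrightarrow> (\<lambda>x. c * f x) \<in> poly_le N"
proof (induction N arbitrary: f)
  case (Suc N)
  from Suc.prems obtain F where F: "\<And>j. F j \<in> poly_le N"
      "\<And>x. f x = (\<Sum>j\<in>UNIV. homog_coord j x * F j x)"
    by (rule poly_le_SucE) (rule that)
  show ?case
    by (rule poly_le_SucI[where F="\<lambda>j x. c * F j x"])
      (intro Suc.IH F(1), simp add: F(2) sum_distrib_left mult.left_commute)
qed auto

lemma poly_le_add: "f \<in> poly_le N \<Longrightarrow> g \<in> poly_le N \<Longrightarrow> (\<lambda>x. f x + g x) \<in> poly_le N"
proof (induction N arbitrary: f g)
  case (Suc N)
  from Suc.prems(1) obtain F where F: "\<And>j. F j \<in> poly_le N"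
      "\<And>x. f x = (\<Sum>j\<in>UNIV. homog_coord j x * F j x)"
    by (rule poly_le_SucE) (rule that)
  from Suc.prems(2) obtain G where G: "\<And>j. G j \<in> poly_le N"
      "\<And>x. g x = (\<Sum>j\<in>UNIV. homog_coord j x * G j x)"
    by (rule poly_le_SucE) (rule that)
  show ?case
    by (rule poly_le_SucI[where F="\<lambda>j x. F j x + G j x"])
      (intro Suc.IH F(1) G(1), simp add: F(2) G(2) sum.distrib distrib_left)
qed auto

lemma poly_le_Suc:
  assumes "f \<in> poly_le N" shows "f \<in> poly_le (Suc N)"
proof (rule poly_le_SucI[where F="\<lambda>j x. (if j = None then 1 else 0) * f x"])
  show "(\<lambda>x. (if j = None then 1 else 0) * f x) \<in> poly_le N" for j
    by (rule poly_le_scale[OF assms])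
qed (simp add: sum_option)

lemma poly_le_mono: "N \<le> M \<Longrightarrow> f \<in> poly_le N \<Longrightarrow> f \<in> poly_le M"
  by (induction M rule: dec_induct) (simp_all only: poly_le_Suc)

lemma poly_le_const: "(\<lambda>x. c) \<in> poly_le N"
  by (rule poly_le_mono[of 0]) auto

lemma poly_le_sum:
  "finite I \<Longrightarrow> (\<And>i. i \<in> I \<Longrightarrow> f i \<in> poly_le N) \<Longrightarrow> (\<lambda>x. \<Sum>i\<in>I. f i x) \<in> poly_le N"
  by (induction I rule: finite_induct) (simp_all add: poly_le_const poly_le_add)

lemma poly_le_mult: "f \<in> poly_le N \<Longrightarrow> g \<in> poly_le M \<Longrightarrow> (\<lambda>x. f x * g x) \<in> poly_le (N + M)"
proof (induction N arbitrary: f)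
  case 0
  then show ?case by (auto intro: poly_le_scale)
next
  case (Suc N)
  from Suc.prems(1) obtain F where F: "\<And>j. F j \<in> poly_le N"
      "\<And>x. f x = (\<Sum>j\<in>UNIV. homog_coord j x * F j x)"
    by (rule poly_le_SucE) (rule that)
  have "(\<lambda>x. f x * g x) \<in> poly_le (Suc (N + M))"
    by (rule poly_le_SucI[where F="\<lambda>j x. F j x * g x"])
      (intro Suc.IH F(1) Suc.prems(2), simp add: F(2) sum_distrib_right mult.assoc)
  then show ?case by simp
qed

lemma poly_le_homog_coord: "homog_coord j \<in> poly_le (Suc 0)"
proof (rule poly_le_SucI[where F="\<lambda>k x. if k = j then 1 else 0"])
  fix x show "homog_coord j x = (\<Sum>k\<in>UNIV. homog_coord k x * (if k = j then 1 else 0))"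
    by (simp add: if_distrib cong: if_cong)
qed (rule poly_le_const)

lemma poly_le_coord: "(\<lambda>x. x $ i) \<in> poly_le (Suc 0)"
  using poly_le_homog_coord[of "Some i"] by simp

lemma linear_eq_sum_axis:
  fixes h :: "real ^ 'n \<Rightarrow> real"
  assumes "linear h" shows "h x = (\<Sum>i\<in>UNIV. x $ i * h (axis i 1))"
proof -
  have "h x = h (\<Sum>i\<in>UNIV. x $ i *\<^sub>R axis i 1)"
    by (simp add: scalar_mult_eq_scaleR[symmetric] basis_expansion)
  also have "\<dots> = (\<Sum>i\<in>UNIV. x $ i * h (axis i 1))"
    by (simp add: linear_sum[OF assms] linear_scale[OF assms])
  finally show ?thesis .
qed

lemma real_polynomial_function_poly_le:
  fixes f :: "real ^ 'n \<Rightarrow> real"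
  assumes "real_polynomial_function f"
  shows "\<exists>N. f \<in> poly_le N"
  using assms
proof (induction rule: real_polynomial_function.induct)
  case (linear h)
  have "(\<lambda>x. \<Sum>i\<in>UNIV. h (axis i 1) * x $ i) \<in> poly_le (Suc 0)"
    by (intro poly_le_sum poly_le_scale poly_le_coord) auto
  moreover have "(\<lambda>x. \<Sum>i\<in>UNIV. h (axis i 1) * x $ i) = h"
    unfolding linear_eq_sum_axis[OF bounded_linear.linear[OF linear], symmetric] mult.commute[of "h _"] ..
  ultimately show ?case by (intro exI[of _ "Suc 0"]) (simp only:)
next
  case (const c)
  then show ?case using poly_le_const by blast
next
  case (add f g)
  then obtain N M where "f \<in> poly_le N" "g \<in> poly_le M" by blast
  then have "f \<in> poly_le (max N M)" "g \<in> poly_le (max N M)"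
    using poly_le_mono[of N "max N M" f] poly_le_mono[of M "max N M" g] by simp_all
  then show ?case using poly_le_add by blast
next
  case (mult f g)
  then show ?case using poly_le_mult by blast
qed

lemma real_polynomial_function_coord: "real_polynomial_function (\<lambda>x::real^'n. x $ i)"
  by (rule real_polynomial_function.intros(1)) (rule bounded_linear_vec_nth)

text \<open>The bound \<open>N\<close> is independent of \<open>a\<close> and \<open>s\<close>. This
  uniformity is what allows one truncation order to serve all segments in Jensen's
  inequality.\<close>

lemma poly_le_affine:
  "f \<in> poly_le N \<Longrightarrow> (\<lambda>x. f (a + s *\<^sub>R (x - a))) \<in> poly_le N"
proof (induction N arbitrary: f)
  case (Suc N)
  from Suc.prems obtain F where F: "\<And>j. F j \<in> poly_le N"
      "\<And>x. f x = (\<Sum>j\<in>UNIV. homog_coord j x * F j x)"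
    by (rule poly_le_SucE) (rule that)
  have "(\<lambda>x. homog_coord j (a + s *\<^sub>R (x - a))) \<in> poly_le (Suc 0)" for j
  proof (cases j)
    case (Some i)
    have "(\<lambda>x. (1 - s) * a $ i + s * x $ i) \<in> poly_le (Suc 0)"
      by (intro poly_le_add poly_le_const poly_le_scale poly_le_coord)
    then show ?thesis using Some by (simp add: algebra_simps)
  qed (simp only: homog_coord.simps poly_le_const)
  then have "(\<lambda>x. \<Sum>j\<in>UNIV. homog_coord j (a + s *\<^sub>R (x - a)) * F j (a + s *\<^sub>R (x - a))) \<in> poly_le (Suc 0 + N)"
    by (intro poly_le_sum poly_le_mult Suc.IH F) auto
  then show ?case by (simp add: F(2))
qed auto

text \<open>Words instead of multisets, so the same monomial function occurs repeatedly. The family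
  only has to span, hence the repetition does no harm.\<close>

definition monomials :: "nat \<Rightarrow> 'n option list set" where
  "monomials N = {js. length js = N}"

lemma monomials_Suc: "monomials (Suc N) = (\<lambda>(j, js). j # js) ` (UNIV \<times> monomials N)"
  by (auto simp: monomials_def length_Suc_conv image_iff)

lemma finite_monomials: "finite (monomials N :: 'n::finite option list set)"
  unfolding monomials_def using finite_lists_length_eq[of "UNIV :: 'n option set" N] by simp

lemma monomial_poly_le: "js \<in> monomials N \<Longrightarrow> monomial js \<in> poly_le N"
proof (induction N arbitrary: js)
  case (Suc N)
  then obtain j ks where "js = j # ks" "ks \<in> monomials N" by (auto simp: monomials_Suc)
  then show ?case
    using poly_le_mult[OF poly_le_homog_coord[of j] Suc.IH[of ks]] by simp
qed (auto simp: monomials_def)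

lemma poly_le_monomials:
  "f \<in> poly_le N \<Longrightarrow> \<exists>z. \<forall>x. f x = (\<Sum>js\<in>monomials N. z js * monomial js x)"
proof (induction N arbitrary: f)
  case 0
  then obtain c where "f = (\<lambda>x. c)" by auto
  then show ?case by (intro exI[of _ "\<lambda>_. c"]) (simp add: monomials_def)
next
  case (Suc N)
  from Suc.prems obtain F where F: "\<And>j. F j \<in> poly_le N"
      "\<And>x. f x = (\<Sum>j\<in>UNIV. homog_coord j x * F j x)"
    by (rule poly_le_SucE) (rule that)
  from Suc.IH[OF F(1)] have "\<forall>j. \<exists>z. \<forall>x. F j x = (\<Sum>js\<in>monomials N. z js * monomial js x)" by blast
  then obtain z where z: "\<And>j x. F j x = (\<Sum>js\<in>monomials N. z j js * monomial js x)" by metis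
  have "f x = (\<Sum>js\<in>monomials (Suc N). z (hd js) (tl js) * monomial js x)" for x
  proof -
    have "inj_on (\<lambda>(j, js). j # js) (UNIV \<times> monomials N)" by (auto simp: inj_on_def)
    then have "(\<Sum>js\<in>monomials (Suc N). z (hd js) (tl js) * monomial js x)
        = (\<Sum>(j, js)\<in>UNIV \<times> monomials N. z j js * (homog_coord j x * monomial js x))"
      unfolding monomials_Suc by (subst sum.reindex) (auto intro!: sum.cong)
    also have "\<dots> = f x"
      by (simp add: F(2) z sum_distrib_left sum.cartesian_product[symmetric] mult_ac)
    finally show ?thesis ..
  qed
  then show ?case by (intro exI[of _ "\<lambda>js. z (hd js) (tl js)"] allI)
qed

text \<open>Each new function \<open>g\<close> costs at most one new point. If \<open>X\<close> no
  longer suffices, it fails at some \<open>y0\<close>, and the defect \<open>e\<close> of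
  \<open>g\<close> there can be used to repair the representation at every other point.\<close>

lemma finite_evaluations_span:
  fixes H :: "('a \<Rightarrow> real) set"
  assumes "finite H"
  shows "\<exists>X. finite X \<and> (\<forall>y. \<exists>c. \<forall>h\<in>H. h y = (\<Sum>x\<in>X. c x * h x))"
  using assms
proof (induction H rule: finite_induct)
  case (insert g H)
  then obtain X where X: "finite X" "\<And>y. \<exists>c. \<forall>h\<in>H. h y = (\<Sum>x\<in>X. c x * h x)" by blast
  show ?case
  proof (cases "\<forall>y. \<exists>c. \<forall>h\<in>insert g H. h y = (\<Sum>x\<in>X. c x * h x)")
    case True
    then show ?thesis using X(1) by blast
  next
    case False
    then obtain y0 where y0: "\<And>c. \<exists>h\<in>insert g H. h y0 \<noteq> (\<Sum>x\<in>X. c x * h x)" by blast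
    obtain c0 where c0: "\<And>h. h \<in> H \<Longrightarrow> h y0 = (\<Sum>x\<in>X. c0 x * h x)" using X(2)[of y0] by blast
    have "y0 \<notin> X"
    proof
      assume "y0 \<in> X"
      then have "h y0 = (\<Sum>x\<in>X. (if x = y0 then 1 else 0) * h x)" for h :: "'a \<Rightarrow> real"
        using X(1) by (simp add: if_distrib[of "\<lambda>t. t * _"] cong: if_cong)
      then show False using y0[of "\<lambda>x. if x = y0 then 1 else 0"] by blast
    qed
    define e where "e = g y0 - (\<Sum>x\<in>X. c0 x * g x)"
    have e: "e \<noteq> 0" using y0[of c0] c0 by (auto simp: e_def)
    have "\<exists>c. \<forall>h\<in>insert g H. h y = (\<Sum>x\<in>insert y0 X. c x * h x)" for y
    proof -
      obtain c where c: "\<And>h. h \<in> H \<Longrightarrow> h y = (\<Sum>x\<in>X. c x * h x)" using X(2)[of y] by blast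
      \<comment> \<open>The functional "evaluate at \<open>y0\<close> minus its
        \<open>c0\<close>-combination" vanishes on \<open>H\<close> and takes the value
        \<open>e\<close> on \<open>g\<close>; adding \<open>t\<close> times it corrects
        \<open>g\<close> and leaves the identities on \<open>H\<close> intact.\<close>
      define t where "t = (g y - (\<Sum>x\<in>X. c x * g x)) / e"
      define c' where "c' x = (if x = y0 then t else c x - t * c0 x)" for x
      have s: "(\<Sum>x\<in>insert y0 X. c' x * h x) = t * (h y0 - (\<Sum>x\<in>X. c0 x * h x)) + (\<Sum>x\<in>X. c x * h x)" for h
      proof -
        have "(\<Sum>x\<in>X. c' x * h x) = (\<Sum>x\<in>X. c x * h x - t * (c0 x * h x))"
          using \<open>y0 \<notin> X\<close> by (intro sum.cong refl) (auto simp: c'_def algebra_simps)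
        then show ?thesis
          using X(1) \<open>y0 \<notin> X\<close>
          by (simp add: c'_def sum_subtractf sum_distrib_left[symmetric] algebra_simps)
      qed
      have "t * e = g y - (\<Sum>x\<in>X. c x * g x)" using e by (simp add: t_def)
      then have "g y = (\<Sum>x\<in>insert y0 X. c' x * g x)" unfolding s e_def[symmetric] by simp
      moreover have "h y = (\<Sum>x\<in>insert y0 X. c' x * h x)" if "h \<in> H" for h
        unfolding s using c0[OF that] c[OF that] by simp
      ultimately show ?thesis by blast
    qed
    then show ?thesis using X(1) by (intro exI[of _ "insert y0 X"]) simp
  qed
qed auto

lemma poly_le_evaluations_span:
  "\<exists>X. finite X \<and> (\<forall>y. \<exists>c. \<forall>f\<in>poly_le N. f y = (\<Sum>x\<in>X. c x * f x))"
proof -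
  obtain X :: "(real^'a) set" where X: "finite X"
      "\<And>y. \<exists>c. \<forall>h\<in>monomial ` monomials N. h y = (\<Sum>x\<in>X. c x * h x)"
    using finite_evaluations_span[of "monomial ` (monomials N :: 'a option list set)"] finite_monomials by blast
  have "\<exists>c. \<forall>f\<in>poly_le N. f y = (\<Sum>x\<in>X. c x * f x)" for y
  proof -
    obtain c where c: "\<And>js. js \<in> monomials N \<Longrightarrow> monomial js y = (\<Sum>x\<in>X. c x * monomial js x)"
      using X(2)[of y] by blast
    have "f y = (\<Sum>x\<in>X. c x * f x)" if f: "f \<in> poly_le N" for f
    proof -
      obtain z where z: "\<And>x. f x = (\<Sum>js\<in>monomials N. z js * monomial js x)"
        using poly_le_monomials[OF f] by blast
      have "f y = (\<Sum>js\<in>monomials N. z js * (\<Sum>x\<in>X. c x * monomial js x))"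
        unfolding z by (intro sum.cong refl) (simp add: c)
      also have "\<dots> = (\<Sum>x\<in>X. c x * f x)"
        unfolding z sum_distrib_left by (subst sum.swap) (simp add: mult_ac)
      finally show ?thesis .
    qed
    then show ?thesis by blast
  qed
  then show ?thesis using X(1) by blast
qed

section \<open>Gradients and Hessians of polynomials\<close>

text \<open>\<open>gradient\<close> is defined through the Frechet derivative; the induction
  exhibits an explicit polynomial gradient, so that first and second derivatives stay within the
  polynomials.\<close>

lemma real_polynomial_function_has_gradient:
  fixes f :: "real ^ 'n \<Rightarrow> real"
  assumes "real_polynomial_function f"
  shows "\<exists>G. (\<forall>i. real_polynomial_function (\<lambda>x. G x $ i)) \<and>
    (\<forall>x. (f has_derivative (\<lambda>v. G x \<bullet> v)) (at x))"
  using assms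
proof (induction rule: real_polynomial_function.induct)
  case (linear h)
  let ?G = "\<lambda>x::real^'n. \<chi> i. h (axis i 1)"
  have hv: "h v = (\<chi> i. h (axis i 1)) \<bullet> v" for v
    using linear_eq_sum_axis[OF bounded_linear.linear[OF linear], of v]
    by (simp add: inner_vec_def mult.commute)
  have "(\<lambda>v. ?G x \<bullet> v) = h" for x by (rule ext) (rule hv[symmetric])
  then show ?case
    by (intro exI[of _ ?G])
      (simp add: bounded_linear_imp_has_derivative[OF linear] real_polynomial_function.intros(2))
next
  case (const c)
  show ?case
    by (intro exI[of _ "\<lambda>x. 0"]) (simp add: real_polynomial_function.intros(2))
next
  case (add f g)
  then obtain F G where F: "\<And>i. real_polynomial_function (\<lambda>x. F x $ i)"
      "\<And>x. (f has_derivative (\<lambda>v. F x \<bullet> v)) (at x)"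
    and G: "\<And>i. real_polynomial_function (\<lambda>x. G x $ i)"
      "\<And>x. (g has_derivative (\<lambda>v. G x \<bullet> v)) (at x)"
    by (elim exE conjE) (rule that, (erule spec)+)
  show ?case
  proof (intro exI[of _ "\<lambda>x. F x + G x"] conjI allI)
    show "real_polynomial_function (\<lambda>x. (F x + G x) $ i)" for i
      using real_polynomial_function.intros(3)[OF F(1)[of i] G(1)[of i]] by simp
    show "((\<lambda>x. f x + g x) has_derivative (\<lambda>v. (F x + G x) \<bullet> v)) (at x)" for x
      using has_derivative_add[OF F(2)[of x] G(2)[of x]] by (simp add: inner_add_left)
  qed
next
  case (mult f g)
  then obtain F G where F: "\<And>i. real_polynomial_function (\<lambda>x. F x $ i)"
      "\<And>x. (f has_derivative (\<lambda>v. F x \<bullet> v)) (at x)"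
    and G: "\<And>i. real_polynomial_function (\<lambda>x. G x $ i)"
      "\<And>x. (g has_derivative (\<lambda>v. G x \<bullet> v)) (at x)"
    by (elim exE conjE) (rule that, (erule spec)+)
  show ?case
  proof (intro exI[of _ "\<lambda>x. f x *\<^sub>R G x + g x *\<^sub>R F x"] conjI allI)
    show "real_polynomial_function (\<lambda>x. (f x *\<^sub>R G x + g x *\<^sub>R F x) $ i)" for i
      using real_polynomial_function.intros(3)[OF real_polynomial_function.intros(4)[OF mult.hyps(1) G(1)[of i]]
          real_polynomial_function.intros(4)[OF mult.hyps(2) F(1)[of i]]] by simp
    show "((\<lambda>x. f x * g x) has_derivative (\<lambda>v. (f x *\<^sub>R G x + g x *\<^sub>R F x) \<bullet> v)) (at x)" for x
      using has_derivative_mult[OF F(2)[of x] G(2)[of x]]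
      by (simp add: inner_add_left mult.commute)
  qed
qed

lemma gradient_eq:
  assumes "(f has_derivative (\<lambda>v. g \<bullet> v)) (at x)"
  shows "gradient f x = g"
  by (simp add: gradient_def vec_eq_iff frechet_derivative_at[OF assms, symmetric] inner_axis)

lemma real_polynomial_function_gradient:
  fixes f :: "real ^ 'n \<Rightarrow> real"
  assumes "real_polynomial_function f"
  shows "(f has_derivative (\<lambda>v. gradient f x \<bullet> v)) (at x)"
    and "real_polynomial_function (\<lambda>x. gradient f x $ i)"
proof -
  obtain G where G: "\<And>i. real_polynomial_function (\<lambda>x. G x $ i)"
      "\<And>x. (f has_derivative (\<lambda>v. G x \<bullet> v)) (at x)"
    using real_polynomial_function_has_gradient[OF assms] by (elim exE conjE) (rule that, (erule spec)+)
  have "gradient f = G" using gradient_eq[OF G(2)] by (rule ext)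
  then show "(f has_derivative (\<lambda>v. gradient f x \<bullet> v)) (at x)"
    "real_polynomial_function (\<lambda>x. gradient f x $ i)" using G by simp_all
qed

lemma has_derivative_hessian:
  fixes f :: "real ^ 'n \<Rightarrow> real"
  assumes "real_polynomial_function f"
  shows "(gradient f has_derivative (\<lambda>v. hessian f x *v v)) (at x)"
proof -
  have "gradient f differentiable (at x)"
  proof (rule differentiable_at_polynomial_function)
    show "polynomial_function (gradient f)"
      unfolding polynomial_function_iff_Basis_inner
      by (auto simp: Basis_vec_def inner_axis intro: real_polynomial_function_gradient(2)[OF assms])
  qed
  then show ?thesis
    unfolding hessian_def jacobian_works .
qed

lemma hessian_eqI:
  fixes f :: "real ^ 'n \<Rightarrow> real"
  assumes "real_polynomial_function f" "(gradient f has_derivative F) (at x)"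
  shows "hessian f x *v v = F v"
  using has_derivative_unique[OF has_derivative_hessian[OF assms(1)] assms(2)] by (simp add: fun_eq_iff)

lemma real_polynomial_function_hessian:
  fixes f :: "real ^ 'n \<Rightarrow> real"
  assumes "real_polynomial_function f"
  shows "real_polynomial_function (\<lambda>x. hessian f x $ i $ j)"
proof -
  let ?g = "\<lambda>x. gradient f x $ i"
  have p: "real_polynomial_function ?g" by (rule real_polynomial_function_gradient(2)[OF assms])
  have "hessian f x $ i $ j = gradient ?g x $ j" for x
  proof -
    have "(?g has_derivative (\<lambda>v. (hessian f x *v v) $ i)) (at x)"
      by (rule bounded_linear.has_derivative[OF bounded_linear_vec_nth has_derivative_hessian[OF assms]])
    from has_derivative_unique[OF real_polynomial_function_gradient(1)[OF p] this]
    have "gradient ?g x \<bullet> axis j 1 = (hessian f x *v axis j 1) $ i" by (simp add: fun_eq_iff)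
    then show ?thesis by (simp add: inner_axis matrix_vector_mul_component)
  qed
  then show ?thesis using real_polynomial_function_gradient(2)[OF p, of j] by simp
qed

lemma second_derivative_line:
  fixes f :: "real ^ 'n \<Rightarrow> real"
  assumes "real_polynomial_function f"
  shows "((\<lambda>s. f (a + s *\<^sub>R v)) has_real_derivative (gradient f (a + s *\<^sub>R v) \<bullet> v)) (at s)"
    and "((\<lambda>s. gradient f (a + s *\<^sub>R v) \<bullet> v) has_real_derivative
           (v \<bullet> (hessian f (a + s *\<^sub>R v) *v v))) (at s)"
proof -
  have l: "((\<lambda>s. a + s *\<^sub>R v) has_derivative (\<lambda>t. t *\<^sub>R v)) (at s)"
    by (auto intro!: derivative_eq_intros)
  have "((\<lambda>s. f (a + s *\<^sub>R v)) has_derivative (\<lambda>t. gradient f (a + s *\<^sub>R v) \<bullet> (t *\<^sub>R v))) (at s)"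
    by (rule has_derivative_compose[OF l real_polynomial_function_gradient(1)[OF assms]])
  then show "((\<lambda>s. f (a + s *\<^sub>R v)) has_real_derivative (gradient f (a + s *\<^sub>R v) \<bullet> v)) (at s)"
    by (simp add: has_field_derivative_def mult_commute_abs)
  have "((\<lambda>s. gradient f (a + s *\<^sub>R v)) has_derivative (\<lambda>t. hessian f (a + s *\<^sub>R v) *v (t *\<^sub>R v))) (at s)"
    by (rule has_derivative_compose[OF l has_derivative_hessian[OF assms]])
  from has_derivative_inner_left[OF this, of v]
  show "((\<lambda>s. gradient f (a + s *\<^sub>R v) \<bullet> v) has_real_derivative
           (v \<bullet> (hessian f (a + s *\<^sub>R v) *v v))) (at s)"
    by (simp add: has_field_derivative_def matrix_vector_mult_scaleR inner_commute mult_commute_abs)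
qed

text \<open>Two applications of the mean value theorem take the place of an integral remainder,
  since only the sign of the second derivative matters.\<close>

lemma second_derivative_nonpos_tangent:
  fixes \<phi> :: "real \<Rightarrow> real"
  assumes "\<And>s. (\<phi> has_real_derivative \<phi>' s) (at s)" "\<And>s. (\<phi>' has_real_derivative \<phi>'' s) (at s)"
    and neg: "\<And>s. 0 \<le> s \<Longrightarrow> s \<le> 1 \<Longrightarrow> \<phi>'' s \<le> 0"
  shows "\<phi> 1 \<le> \<phi> 0 + \<phi>' 0"
proof -
  obtain t where t: "0 < t" "t < 1" "\<phi> 1 - \<phi> 0 = (1 - 0) * \<phi>' t"
    using MVT2[of 0 1 \<phi> \<phi>'] assms(1) by auto
  obtain r where r: "0 < r" "r < t" "\<phi>' t - \<phi>' 0 = (t - 0) * \<phi>'' r"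
    using MVT2[of 0 t \<phi>' \<phi>''] assms(2) t(1) by auto
  have "\<phi>'' r \<le> 0" using neg[of r] r t by simp
  then have "t * \<phi>'' r \<le> 0" using t(1) by (simp add: mult_nonneg_nonpos)
  then show ?thesis using t r by simp
qed

section \<open>Jensen's inequality for localized moment functionals\<close>

text \<open>
  A finitely supported weight \<open>c\<close> on \<open>X\<close> stands for the linear functional
  \<open>p \<mapsto> \<Sum>x\<in>X. c x * p x\<close> on polynomials of bounded degree.
\<close>

definition moment_psd :: "nat \<Rightarrow> (real ^ 'n \<Rightarrow> real) \<Rightarrow> (real ^ 'n) set \<Rightarrow> (real ^ 'n \<Rightarrow> real) \<Rightarrow> bool" where
  "moment_psd N w X c \<longleftrightarrow> (\<forall>p\<in>poly_le N. 0 \<le> (\<Sum>x\<in>X. c x * w x * (p x)\<^sup>2))"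

lemma moment_psd_mono: "moment_psd M w X c \<Longrightarrow> N \<le> M \<Longrightarrow> moment_psd N w X c"
  unfolding moment_psd_def using poly_le_mono by blast

abbreviation ball_poly :: "real ^ 'n \<Rightarrow> real \<Rightarrow> real ^ 'n \<Rightarrow> real" where
  "ball_poly u d \<equiv> \<lambda>x. d\<^sup>2 - (norm (x - u))\<^sup>2"

text \<open>The matrix analogue of a quadratic module: forms in \<open>v\<close> with coefficients
  polynomial in \<open>x\<close>, visibly nonnegative wherever \<open>b\<close> is. Sums of the
  first kind are the forms of W(x)^T W(x).\<close>

inductive form_cone :: "(real ^ 'n \<Rightarrow> real) \<Rightarrow> (real ^ 'n \<Rightarrow> real ^ 'n \<Rightarrow> real) \<Rightarrow> bool"
  for b where
  square: "(\<And>i. real_polynomial_function (w i)) \<Longrightarrow> form_cone b (\<lambda>x v. (\<Sum>i\<in>UNIV. w i x * v $ i)\<^sup>2)"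
| weighted: "(\<And>i. real_polynomial_function (w i)) \<Longrightarrow> form_cone b (\<lambda>x v. b x * (\<Sum>i\<in>UNIV. w i x * v $ i)\<^sup>2)"
| sum: "form_cone b F \<Longrightarrow> form_cone b G \<Longrightarrow> form_cone b (\<lambda>x v. F x v + G x v)"

text \<open>Concavity with an explicit remainder: the excess over linear interpolation is s(1 - s)
  times a sum of squares in \<open>x\<close>. Positivity at the moved point thus reduces to
  positivity on squares and on ball-weighted squares at \<open>x\<close> itself.\<close>

lemma ball_poly_segment:
  "ball_poly u d (a + s *\<^sub>R (x - a))
    = (1 - s) * ball_poly u d a + s * ball_poly u d x + s * (1 - s) * (norm (x - a))\<^sup>2"
  unfolding power2_norm_eq_inner by (simp add: inner_simps inner_commute algebra_simps)

lemma form_poly_le: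
  fixes w :: "'n \<Rightarrow> real ^ 'n \<Rightarrow> real"
  assumes "\<And>i. real_polynomial_function (w i)"
  shows "\<exists>N. \<forall>a s. (\<lambda>x. \<Sum>i\<in>UNIV. w i (a + s *\<^sub>R (x - a)) * (x - a) $ i) \<in> poly_le N"
proof -
  have "\<forall>i. \<exists>N. w i \<in> poly_le N" using real_polynomial_function_poly_le assms by blast
  then obtain N where N: "\<And>i. w i \<in> poly_le (N i)" by metis
  define M where "M = Max (range N)"
  have M: "w i \<in> poly_le M" for i
    by (rule poly_le_mono[OF _ N[of i]]) (simp add: M_def)
  have "(\<lambda>x. \<Sum>i\<in>UNIV. w i (a + s *\<^sub>R (x - a)) * (x - a) $ i) \<in> poly_le (M + Suc 0)" for a s
  proof (intro poly_le_sum poly_le_mult poly_le_affine M)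
    fix i
    have "(\<lambda>x. x $ i + (- a $ i)) \<in> poly_le (Suc 0)"
      by (intro poly_le_add poly_le_const poly_le_coord)
    then show "(\<lambda>x. (x - a) $ i) \<in> poly_le (Suc 0)" by simp
  qed simp
  then show ?thesis by blast
qed

text \<open>Substituting the moved point and v = x - a turns each generator into a square, or a
  weighted square, of a polynomial in \<open>x\<close> whose degree is bounded uniformly in
  \<open>a\<close> and \<open>s\<close>.\<close>

lemma form_cone_moment_nonneg:
  fixes u :: "real ^ 'n"
  assumes "form_cone (ball_poly u d) F"
  shows "\<exists>N. \<forall>X c a s. moment_psd N (\<lambda>_. 1) X c \<longrightarrow> moment_psd N (ball_poly u d) X c \<longrightarrow>
      0 \<le> ball_poly u d a \<longrightarrow> 0 \<le> s \<longrightarrow> s \<le> 1 \<longrightarrow> 0 \<le> (\<Sum>x\<in>X. c x * F (a + s *\<^sub>R (x - a)) (x - a))"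
  using assms
proof (induction rule: form_cone.induct)
  case (square w)
  obtain N where N: "\<And>a s. (\<lambda>x. \<Sum>i\<in>UNIV. w i (a + s *\<^sub>R (x - a)) * (x - a) $ i) \<in> poly_le N"
    using form_poly_le[of w] square by blast
  show ?case
  proof (intro exI[of _ N] allI impI)
    fix X :: "(real ^ 'n) set" and c a s assume m: "moment_psd N (\<lambda>_. 1) X c"
    show "0 \<le> (\<Sum>x\<in>X. c x * (\<Sum>i\<in>UNIV. w i (a + s *\<^sub>R (x - a)) * (x - a) $ i)\<^sup>2)"
      using m[unfolded moment_psd_def, rule_format, OF N[of a s]] by simp
  qed
next
  case (weighted w)
  obtain N where N: "\<And>a s. (\<lambda>x. \<Sum>i\<in>UNIV. w i (a + s *\<^sub>R (x - a)) * (x - a) $ i) \<in> poly_le N"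
    using form_poly_le[of w] weighted by blast
  show ?case
  \<comment> \<open>The remainder term of \<open>ball_poly_segment\<close> multiplies
    \<open>q\<close> by coordinates of x - a, which raises the degree by one.\<close>
  proof (intro exI[of _ "N + Suc 0"] allI impI)
    fix X c a and s :: real
    assume m: "moment_psd (N + Suc 0) (\<lambda>_. 1) X c" "moment_psd (N + Suc 0) (ball_poly u d) X c"
      and a: "0 \<le> ball_poly u d a" and s: "0 \<le> s" "s \<le> 1"
    define q where "q x = (\<Sum>i\<in>UNIV. w i (a + s *\<^sub>R (x - a)) * (x - a) $ i)" for x
    have q: "q \<in> poly_le N" using N[of a s] by (simp add: q_def[abs_def])
    then have q': "q \<in> poly_le (N + Suc 0)" by (rule poly_le_mono[rotated]) simp
    have r: "(\<lambda>x. q x * (x - a) $ i) \<in> poly_le (N + Suc 0)" for i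
    proof (intro poly_le_mult q)
      have "(\<lambda>x. x $ i + (- a $ i)) \<in> poly_le (Suc 0)"
        by (intro poly_le_add poly_le_const poly_le_coord)
      then show "(\<lambda>x. (x - a) $ i) \<in> poly_le (Suc 0)" by simp
    qed
    have "(\<Sum>x\<in>X. c x * (ball_poly u d (a + s *\<^sub>R (x - a)) * (q x)\<^sup>2))
       = (1 - s) * ball_poly u d a * (\<Sum>x\<in>X. c x * 1 * (q x)\<^sup>2)
        + s * (\<Sum>x\<in>X. c x * ball_poly u d x * (q x)\<^sup>2)
        + s * (1 - s) * (\<Sum>i\<in>UNIV. \<Sum>x\<in>X. c x * 1 * (q x * (x - a) $ i)\<^sup>2)"
    proof -
      have "(\<Sum>i\<in>UNIV. \<Sum>x\<in>X. c x * 1 * (q x * (x - a) $ i)\<^sup>2) = (\<Sum>x\<in>X. c x * (q x)\<^sup>2 * (norm (x - a))\<^sup>2)"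
        unfolding power2_norm_eq_inner inner_vec_def
        by (subst sum.swap) (simp add: sum_distrib_left power2_eq_square mult_ac)
      then show ?thesis
        unfolding ball_poly_segment by (simp add: sum_distrib_left sum.distrib[symmetric] algebra_simps)
    qed
    also have "\<dots> \<ge> 0"
      using m[unfolded moment_psd_def] q' r a s
      by (intro add_nonneg_nonneg mult_nonneg_nonneg sum_nonneg[of UNIV]) auto
    finally show "0 \<le> (\<Sum>x\<in>X. c x * (ball_poly u d (a + s *\<^sub>R (x - a)) *
        (\<Sum>i\<in>UNIV. w i (a + s *\<^sub>R (x - a)) * (x - a) $ i)\<^sup>2))"
      unfolding q_def .
  qed
next
  case (sum F G)
  then obtain N M where
    N: "\<forall>X c a s. moment_psd N (\<lambda>_. 1) X c \<longrightarrow> moment_psd N (ball_poly u d) X c \<longrightarrow>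
      0 \<le> ball_poly u d a \<longrightarrow> 0 \<le> s \<longrightarrow> s \<le> 1 \<longrightarrow> 0 \<le> (\<Sum>x\<in>X. c x * F (a + s *\<^sub>R (x - a)) (x - a))" and
    M: "\<forall>X c a s. moment_psd M (\<lambda>_. 1) X c \<longrightarrow> moment_psd M (ball_poly u d) X c \<longrightarrow>
      0 \<le> ball_poly u d a \<longrightarrow> 0 \<le> s \<longrightarrow> s \<le> 1 \<longrightarrow> 0 \<le> (\<Sum>x\<in>X. c x * G (a + s *\<^sub>R (x - a)) (x - a))"
    by (elim exE) (rule that)
  show ?case
  proof (intro exI[of _ "max N M"] allI impI)
    fix X c a and s :: real
    assume m: "moment_psd (max N M) (\<lambda>_. 1) X c" "moment_psd (max N M) (ball_poly u d) X c"
      and a: "0 \<le> ball_poly u d a" and s: "0 \<le> s" "s \<le> 1"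
    have "0 \<le> (\<Sum>x\<in>X. c x * F (a + s *\<^sub>R (x - a)) (x - a))"
      by (rule N[rule_format]) (use m[THEN moment_psd_mono, of N] a s in auto)
    moreover have "0 \<le> (\<Sum>x\<in>X. c x * G (a + s *\<^sub>R (x - a)) (x - a))"
      by (rule M[rule_format]) (use m[THEN moment_psd_mono, of M] a s in auto)
    ultimately show "0 \<le> (\<Sum>x\<in>X. c x * (F (a + s *\<^sub>R (x - a)) (x - a) + G (a + s *\<^sub>R (x - a)) (x - a)))"
      by (simp add: distrib_left sum.distrib)
  qed
qed

text \<open>\<open>X\<close>, \<open>c\<close> and \<open>a\<close> are universally quantified, so
  one truncation order serves every functional. For ball polynomials the premise
  \<open>0 \<le> b a\<close> is later supplied by \<open>moment_barycentre_in_ball\<close>.\<close>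

definition jensen_at :: "nat \<Rightarrow> (real ^ 'n \<Rightarrow> real) \<Rightarrow> (real ^ 'n \<Rightarrow> real) \<Rightarrow> bool" where
  "jensen_at N b g \<longleftrightarrow> (\<forall>X c a. moment_psd N (\<lambda>_. 1) X c \<longrightarrow> moment_psd N b X c \<longrightarrow>
     (\<Sum>x\<in>X. c x) = 1 \<longrightarrow> (\<Sum>x\<in>X. c x *\<^sub>R x) = a \<longrightarrow> 0 \<le> b a \<longrightarrow> (\<Sum>x\<in>X. c x * g x) \<le> g a)"

lemma jensen_at_mono: "jensen_at N b g \<Longrightarrow> N \<le> M \<Longrightarrow> jensen_at M b g"
  unfolding jensen_at_def using moment_psd_mono by blast

lemma jensen_at_form_cone:
  assumes g: "real_polynomial_function g"
    and F: "form_cone (ball_poly u d) (\<lambda>x v. - (v \<bullet> (hessian g x *v v)))"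
  shows "\<exists>N. jensen_at N (ball_poly u d) g"
proof -
  obtain N where N: "\<forall>X c a s. moment_psd N (\<lambda>_. 1) X c \<longrightarrow> moment_psd N (ball_poly u d) X c \<longrightarrow>
      0 \<le> ball_poly u d a \<longrightarrow> 0 \<le> s \<longrightarrow> s \<le> 1 \<longrightarrow>
      0 \<le> (\<Sum>x\<in>X. c x * - ((x - a) \<bullet> (hessian g (a + s *\<^sub>R (x - a)) *v (x - a))))"
    using form_cone_moment_nonneg[OF F] by blast
  have "jensen_at N (ball_poly u d) g"
    unfolding jensen_at_def
  proof (intro allI impI)
    fix X c a
    assume m: "moment_psd N (\<lambda>_. 1) X c" "moment_psd N (ball_poly u d) X c"
      and one: "(\<Sum>x\<in>X. c x) = 1" and bary: "(\<Sum>x\<in>X. c x *\<^sub>R x) = a" and a: "0 \<le> ball_poly u d a"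
    \<comment> \<open>The functional is applied to \<open>g\<close> on the dilation about the
      barycentre: s = 0 collapses everything to \<open>a\<close>, s = 1 gives back the
      original.\<close>
    define \<phi> where "\<phi> s = (\<Sum>x\<in>X. c x * g (a + s *\<^sub>R (x - a)))" for s
    define \<phi>' where "\<phi>' s = (\<Sum>x\<in>X. c x * (gradient g (a + s *\<^sub>R (x - a)) \<bullet> (x - a)))" for s
    define \<phi>'' where "\<phi>'' s = (\<Sum>x\<in>X. c x * ((x - a) \<bullet> (hessian g (a + s *\<^sub>R (x - a)) *v (x - a))))" for s
    have "\<phi> 1 \<le> \<phi> 0 + \<phi>' 0"
    proof (rule second_derivative_nonpos_tangent)
      show "(\<phi> has_real_derivative \<phi>' s) (at s)" for s
        unfolding \<phi>_def[abs_def] \<phi>'_def by (intro DERIV_sum DERIV_cmult second_derivative_line g)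
      show "(\<phi>' has_real_derivative \<phi>'' s) (at s)" for s
        unfolding \<phi>'_def[abs_def] \<phi>''_def by (intro DERIV_sum DERIV_cmult second_derivative_line g)
      show "\<phi>'' s \<le> 0" if "0 \<le> s" "s \<le> 1" for s
        using N[rule_format, OF m a that] by (simp add: \<phi>''_def sum_negf)
    qed
    moreover have "\<phi> 0 = g a"
      by (simp add: \<phi>_def sum_distrib_right[symmetric] one)
    \<comment> \<open>The first-order term vanishes because \<open>a\<close> is the barycentre and
      the total mass is one.\<close>
    moreover have "\<phi>' 0 = 0"
    proof -
      have "\<phi>' 0 = gradient g a \<bullet> ((\<Sum>x\<in>X. c x *\<^sub>R x) - (\<Sum>x\<in>X. c x) *\<^sub>R a)"
        by (simp add: \<phi>'_def inner_diff_right inner_sum_right inner_scaleR_right right_diff_distrib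
            sum_subtractf sum_distrib_right)
      then show ?thesis by (simp add: one bary)
    qed
    moreover have "\<phi> 1 = (\<Sum>x\<in>X. c x * g x)" by (simp add: \<phi>_def)
    ultimately show "(\<Sum>x\<in>X. c x * g x) \<le> g a" by simp
  qed
  then show ?thesis ..
qed

section \<open>Local concavity certificates\<close>

inductive quadratic_module :: "(real ^ 'n \<Rightarrow> real) \<Rightarrow> (real ^ 'n \<Rightarrow> real) \<Rightarrow> bool" for b where
  square: "real_polynomial_function p \<Longrightarrow> quadratic_module b (\<lambda>x. (p x)\<^sup>2)"
| weighted: "real_polynomial_function p \<Longrightarrow> quadratic_module b (\<lambda>x. b x * (p x)\<^sup>2)"
| sum: "quadratic_module b f \<Longrightarrow> quadratic_module b g \<Longrightarrow> quadratic_module b (\<lambda>x. f x + g x)"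

lemma quadratic_module_mult_square:
  assumes q: "real_polynomial_function q" and f: "quadratic_module b f"
  shows "quadratic_module b (\<lambda>x. (q x)\<^sup>2 * f x)"
  using f
proof (induction rule: quadratic_module.induct)
  case (square p)
  show ?case
    using quadratic_module.square[OF real_polynomial_function.intros(4)[OF q square]]
    by (simp add: power_mult_distrib)
next
  case (weighted p)
  show ?case
    using quadratic_module.weighted[OF real_polynomial_function.intros(4)[OF q weighted], of b]
    by (simp add: power_mult_distrib mult_ac)
next
  case (sum f g)
  show ?case
    using quadratic_module.sum[OF sum.IH] by (simp add: distrib_left)
qed

lemma quadratic_module_scale:
  assumes "0 \<le> c" "quadratic_module b f"
  shows "quadratic_module b (\<lambda>x. c * f x)"
  using quadratic_module_mult_square[OF real_polynomial_function.intros(2)[of "sqrt c"] assms(2)] assms(1)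
  by simp

lemma quadratic_module_const: "0 \<le> c \<Longrightarrow> quadratic_module b (\<lambda>x. c)"
  using quadratic_module.square[OF real_polynomial_function.intros(2)[of "sqrt c"], of b] by simp

lemma quadratic_module_sum:
  assumes "finite I" "\<And>i. i \<in> I \<Longrightarrow> quadratic_module b (f i)"
  shows "quadratic_module b (\<lambda>x. \<Sum>i\<in>I. f i x)"
  using assms
  by (induction I rule: finite_induct) (simp_all add: quadratic_module_const quadratic_module.sum)

text \<open>An algebraic version of p(x) tending to 0 as x tends to u: the bounds -\<epsilon> \<le>
  p \<le> \<epsilon> on a small ball are replaced by membership in its quadratic module.\<close>

definition small_at :: "real ^ 'n \<Rightarrow> (real ^ 'n \<Rightarrow> real) \<Rightarrow> bool" where
  "small_at u p \<longleftrightarrow> (\<forall>\<epsilon>>0. \<forall>\<^sub>F d in at_right 0.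
     quadratic_module (ball_poly u d) (\<lambda>x. \<epsilon> + p x) \<and> quadratic_module (ball_poly u d) (\<lambda>x. \<epsilon> - p x))"

lemma small_at_zero: "small_at u (\<lambda>x. 0)"
  by (simp add: small_at_def quadratic_module_const)

lemma small_at_add:
  assumes p: "small_at u p" and q: "small_at u q"
  shows "small_at u (\<lambda>x. p x + q x)"
  unfolding small_at_def
proof (intro allI impI)
  fix \<epsilon> :: real assume "0 < \<epsilon>"
  then have e: "0 < \<epsilon> / 2" by simp
  show "\<forall>\<^sub>F d in at_right 0. quadratic_module (ball_poly u d) (\<lambda>x. \<epsilon> + (p x + q x)) \<and>
      quadratic_module (ball_poly u d) (\<lambda>x. \<epsilon> - (p x + q x))"
    using p[unfolded small_at_def, rule_format, OF e] q[unfolded small_at_def, rule_format, OF e]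
  proof eventually_elim
    case (elim d)
    have "(\<lambda>x. \<epsilon> / 2 + p x + (\<epsilon> / 2 + q x)) = (\<lambda>x. \<epsilon> + (p x + q x))"
      "(\<lambda>x. \<epsilon> / 2 - p x + (\<epsilon> / 2 - q x)) = (\<lambda>x. \<epsilon> - (p x + q x))"
      by (auto simp: fun_eq_iff field_simps)
    then show ?case
      using quadratic_module.sum[of "ball_poly u d" "\<lambda>x. \<epsilon> / 2 + p x" "\<lambda>x. \<epsilon> / 2 + q x"]
        quadratic_module.sum[of "ball_poly u d" "\<lambda>x. \<epsilon> / 2 - p x" "\<lambda>x. \<epsilon> / 2 - q x"] elim by simp
  qed
qed

lemma small_at_minus:
  assumes "small_at u p" shows "small_at u (\<lambda>x. - p x)"
  using assms unfolding small_at_def by (simp add: conj_commute)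

lemma small_at_scale_pos:
  assumes p: "small_at u p" and c: "0 < c"
  shows "small_at u (\<lambda>x. c * p x)"
  unfolding small_at_def
proof (intro allI impI)
  fix \<epsilon> :: real assume "0 < \<epsilon>"
  then have e: "0 < \<epsilon> / c" using c by simp
  show "\<forall>\<^sub>F d in at_right 0. quadratic_module (ball_poly u d) (\<lambda>x. \<epsilon> + c * p x) \<and>
      quadratic_module (ball_poly u d) (\<lambda>x. \<epsilon> - c * p x)"
    using p[unfolded small_at_def, rule_format, OF e]
  proof eventually_elim
    case (elim d)
    have "(\<lambda>x. c * (\<epsilon> / c + p x)) = (\<lambda>x. \<epsilon> + c * p x)"
      "(\<lambda>x. c * (\<epsilon> / c - p x)) = (\<lambda>x. \<epsilon> - c * p x)"
      using c by (auto simp: fun_eq_iff field_simps)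
    then show ?case
      using quadratic_module_scale[of c "ball_poly u d" "\<lambda>x. \<epsilon> / c + p x"]
        quadratic_module_scale[of c "ball_poly u d" "\<lambda>x. \<epsilon> / c - p x"] elim c by simp
  qed
qed

lemma small_at_scale:
  assumes "small_at u p" shows "small_at u (\<lambda>x. c * p x)"
proof (cases c "0::real" rule: linorder_cases)
  case less
  then show ?thesis using small_at_minus[OF small_at_scale_pos[OF assms, of "-c"]] by simp
next
  case equal
  then show ?thesis by (simp add: small_at_zero)
next
  case greater
  then show ?thesis by (rule small_at_scale_pos[OF assms])
qed

lemma small_at_sum:
  assumes "finite I" "\<And>i. i \<in> I \<Longrightarrow> small_at u (f i)"
  shows "small_at u (\<lambda>x. \<Sum>i\<in>I. f i x)"
  using assms by (induction I rule: finite_induct) (simp_all add: small_at_zero small_at_add)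

text \<open>With \<epsilon> = \<delta>^2, the identity (\<delta> + p)^2 (\<delta> - p) + (\<delta> -
  p)^2 (\<delta> + p) = 2 \<delta> (\<delta>^2 - p^2) derives the upper bound from the two linear
  bounds, using multiplication by squares only.\<close>

lemma small_at_square:
  assumes p: "small_at u p" and poly: "real_polynomial_function p"
  shows "small_at u (\<lambda>x. (p x)\<^sup>2)"
  unfolding small_at_def
proof (intro allI impI)
  fix \<epsilon> :: real assume e: "0 < \<epsilon>"
  define \<delta> where "\<delta> = sqrt \<epsilon>"
  have d: "0 < \<delta>" "\<epsilon> = \<delta>\<^sup>2" using e by (simp_all add: \<delta>_def)
  have rp: "real_polynomial_function (\<lambda>x. \<delta> + p x)" "real_polynomial_function (\<lambda>x. \<delta> - p x)"
    using real_polynomial_function.intros(3)[OF real_polynomial_function.intros(2) poly]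
      real_polynomial_function_diff[OF real_polynomial_function.intros(2) poly] by blast+
  show "\<forall>\<^sub>F d in at_right 0. quadratic_module (ball_poly u d) (\<lambda>x. \<epsilon> + (p x)\<^sup>2) \<and>
      quadratic_module (ball_poly u d) (\<lambda>x. \<epsilon> - (p x)\<^sup>2)"
    using p[unfolded small_at_def, rule_format, OF d(1)]
  proof eventually_elim
    case (elim r)
    have "quadratic_module (ball_poly u r)
        (\<lambda>x. (1 / (2 * \<delta>)) * ((\<delta> + p x)\<^sup>2 * (\<delta> - p x) + (\<delta> - p x)\<^sup>2 * (\<delta> + p x)))"
      using elim d
      by (intro quadratic_module_scale quadratic_module.sum[OF quadratic_module_mult_square[OF rp(1)]
          quadratic_module_mult_square[OF rp(2)]]) auto
    moreover have "(1 / (2 * \<delta>)) * ((\<delta> + t)\<^sup>2 * (\<delta> - t) + (\<delta> - t)\<^sup>2 * (\<delta> + t)) = \<epsilon> - t\<^sup>2" for t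
      using d(1) unfolding d(2) by (simp add: field_simps power2_eq_square)
    moreover have "quadratic_module (ball_poly u r) (\<lambda>x. \<epsilon> + (p x)\<^sup>2)"
      using e by (intro quadratic_module.sum quadratic_module.square poly quadratic_module_const) simp
    ultimately show ?case by simp
  qed
qed

text \<open>Polarization reduces products to squares.\<close>

lemma small_at_mult:
  assumes p: "small_at u p" "real_polynomial_function p" and q: "small_at u q" "real_polynomial_function q"
  shows "small_at u (\<lambda>x. p x * q x)"
proof -
  have "small_at u (\<lambda>x. (1/4) * (p x + q x)\<^sup>2 + (-1/4) * (p x + (-1) * q x)\<^sup>2)"
    by (intro small_at_add small_at_scale small_at_square p q real_polynomial_function.intros(3)
        real_polynomial_function.intros(4)[OF real_polynomial_function.intros(2)])
  moreover have "(1/4) * (a + b)\<^sup>2 + (-1/4) * (a + (-1) * b)\<^sup>2 = a * b" for a b :: real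
    by (simp add: power2_eq_square algebra_simps)
  ultimately show ?thesis by simp
qed

lemma norm_sq_eq_sum: "(norm x)\<^sup>2 = (\<Sum>i\<in>UNIV. (x $ i)\<^sup>2)" for x :: "real ^ 'n"
  unfolding power2_norm_eq_inner inner_vec_def by (simp add: power2_eq_square)

lemma real_polynomial_function_coord_diff: "real_polynomial_function (\<lambda>x. x $ i - u $ i)"
  by (rule real_polynomial_function_diff[OF real_polynomial_function_coord real_polynomial_function.intros(2)])

text \<open>Write t for x - u. Adding (d + \<sigma> t_i)^2 and the squares t_j^2 with j \<noteq> i
  to d^2 - |t|^2 leaves 2 d (d + \<sigma> t_i); the two signs \<sigma> give both bounds on the
  coordinate.\<close>

lemma quadratic_module_ball_coord:
  fixes u :: "real ^ 'n"
  assumes d: "0 < d" and \<sigma>: "\<sigma>\<^sup>2 = 1"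
  shows "quadratic_module (ball_poly u d) (\<lambda>x. d + \<sigma> * (x $ i - u $ i))"
proof -
  let ?t = "\<lambda>i x::real^'n. x $ i - u $ i"
  have "quadratic_module (ball_poly u d)
      (\<lambda>x. (1 / (2 * d)) * ((d + \<sigma> * ?t i x)\<^sup>2 + (ball_poly u d x * 1\<^sup>2 + (\<Sum>j\<in>UNIV - {i}. (?t j x)\<^sup>2))))"
    using d
    by (intro quadratic_module_scale quadratic_module.sum quadratic_module_sum quadratic_module.square
        quadratic_module.weighted real_polynomial_function.intros(2-4) real_polynomial_function_coord_diff) auto
  moreover have "(1 / (2 * d)) * ((d + \<sigma> * ?t i x)\<^sup>2 + (ball_poly u d x * 1\<^sup>2 + (\<Sum>j\<in>UNIV - {i}. (?t j x)\<^sup>2)))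
      = d + \<sigma> * ?t i x" for x
  proof -
    have n: "(norm (x - u))\<^sup>2 = (?t i x)\<^sup>2 + (\<Sum>j\<in>UNIV - {i}. (?t j x)\<^sup>2)"
      unfolding norm_sq_eq_sum by (subst sum.remove[of _ i]) auto
    have e: "(d + \<sigma> * t)\<^sup>2 = d\<^sup>2 + 2 * d * \<sigma> * t + t\<^sup>2" for t
      using \<sigma> by (simp add: power2_sum power_mult_distrib)
    have "(1 / (2 * d)) * (d\<^sup>2 + 2 * d * \<sigma> * t + t\<^sup>2 + ((d\<^sup>2 - (t\<^sup>2 + S)) * 1\<^sup>2 + S)) = d + \<sigma> * t" for t S
      using d by (simp add: field_simps power2_eq_square)
    then show ?thesis unfolding n e .
  qed
  ultimately show ?thesis by simp
qed

lemma small_at_coord: "small_at u (\<lambda>x. x $ i - u $ i)"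
  unfolding small_at_def
proof (intro allI impI)
  fix \<epsilon> :: real assume e: "0 < \<epsilon>"
  have "\<forall>\<^sub>F d in at_right 0. 0 < d \<and> d < \<epsilon>"
    unfolding eventually_at_right_field using e by (intro exI[of _ \<epsilon>]) auto
  then show "\<forall>\<^sub>F d in at_right 0. quadratic_module (ball_poly u d) (\<lambda>x. \<epsilon> + (x $ i - u $ i)) \<and>
      quadratic_module (ball_poly u d) (\<lambda>x. \<epsilon> - (x $ i - u $ i))"
  proof eventually_elim
    case (elim d)
    have *: "quadratic_module (ball_poly u d) (\<lambda>x. (\<epsilon> - d) + (d + \<sigma> * (x $ i - u $ i)))" if "\<sigma>\<^sup>2 = 1" for \<sigma>
      using elim that by (intro quadratic_module.sum quadratic_module_const quadratic_module_ball_coord) auto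
    show ?case using *[of 1] *[of "-1"] by (simp add: algebra_simps)
  qed
qed

lemma small_at_polynomial:
  fixes p :: "real ^ 'n \<Rightarrow> real"
  assumes "real_polynomial_function p"
  shows "small_at u (\<lambda>x. p x - p u)"
  using assms
proof (induction rule: real_polynomial_function.induct)
  case (linear h)
  have "small_at u (\<lambda>x. \<Sum>i\<in>UNIV. h (axis i 1) * (x $ i - u $ i))"
    by (intro small_at_sum small_at_scale small_at_coord) simp
  moreover have "(\<Sum>i\<in>UNIV. h (axis i 1) * (x $ i - u $ i)) = h x - h u" for x
    unfolding linear_eq_sum_axis[OF bounded_linear.linear[OF linear], of x]
      linear_eq_sum_axis[OF bounded_linear.linear[OF linear], of u]
    by (simp only: sum_subtractf[symmetric] left_diff_distrib[symmetric] mult.commute)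
  ultimately show ?case by simp
next
  case (const c)
  show ?case by (simp add: small_at_zero)
next
  case (add f g)
  show ?case using small_at_add[OF add.IH] by (simp add: algebra_simps)
next
  case (mult f g)
  \<comment> \<open>Expansion of f g - f(u) g(u) in the increments of \<open>f\<close> and
    \<open>g\<close>, to which the induction hypotheses apply.\<close>
  have "small_at u (\<lambda>x. (f x - f u) * (g x - g u) + (f u * (g x - g u) + g u * (f x - f u)))"
    by (intro small_at_add small_at_scale small_at_mult mult.IH real_polynomial_function_diff
        mult.hyps real_polynomial_function.intros(2))
  then show ?case by (simp add: algebra_simps)
qed

section \<open>Certificates for quadratic forms\<close>

lemma form_cone_mult:
  assumes "quadratic_module b f"
  shows "form_cone b (\<lambda>x v. f x * (\<Sum>i\<in>UNIV. l i * v $ i)\<^sup>2)"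
  using assms
proof (induction rule: quadratic_module.induct)
  case (square p)
  have "form_cone b (\<lambda>x v. (\<Sum>i\<in>UNIV. (p x * l i) * v $ i)\<^sup>2)"
    by (intro form_cone.square real_polynomial_function.intros(4) square real_polynomial_function.intros(2))
  then show ?case by (simp add: mult.assoc sum_distrib_left[symmetric] power_mult_distrib)
next
  case (weighted p)
  have "form_cone b (\<lambda>x v. b x * (\<Sum>i\<in>UNIV. (p x * l i) * v $ i)\<^sup>2)"
    by (intro form_cone.weighted real_polynomial_function.intros(4) weighted real_polynomial_function.intros(2))
  then show ?case by (simp add: mult.assoc sum_distrib_left[symmetric] power_mult_distrib)
next
  case (sum f g)
  show ?case using form_cone.sum[OF sum.IH] by (simp add: distrib_right)
qed

lemma form_cone_sum:
  assumes "finite I" "\<And>i. i \<in> I \<Longrightarrow> form_cone b (F i)"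
  shows "form_cone b (\<lambda>x v. \<Sum>i\<in>I. F i x v)"
  using assms
proof (induction I rule: finite_induct)
  case empty
  show ?case
    using form_cone.square[of "\<lambda>_ _. 0" b] real_polynomial_function.intros(2)[of 0] by simp
next
  case (insert i I)
  then show ?case using form_cone.sum[of b "F i" "\<lambda>x v. \<Sum>i\<in>I. F i x v"] by simp
qed

lemma inner_matrix_vector: "v \<bullet> (A *v v) = (\<Sum>i\<in>UNIV. \<Sum>j\<in>UNIV. A $ i $ j * v $ i * v $ j)"
  for A :: "real ^ 'n ^ 'n"
  by (simp add: inner_vec_def matrix_vector_mult_def sum_distrib_left mult_ac)

text \<open>Each row of W contributes the square of a linear form in \<open>v\<close>. No weighted
  generator occurs, hence \<open>b\<close> is arbitrary.\<close>

lemma form_cone_sos_concave: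
  fixes g :: "real ^ 'n \<Rightarrow> real"
  assumes "sos_concave g"
  shows "form_cone b (\<lambda>x v. - (v \<bullet> (hessian g x *v v)))"
proof -
  obtain r :: nat and W :: "nat \<Rightarrow> 'n \<Rightarrow> real ^ 'n \<Rightarrow> real" where
    W: "\<forall>l<r. \<forall>i. real_polynomial_function (W l i)"
      "\<forall>x. - hessian g x = (\<chi> i j. \<Sum>l<r. W l i x * W l j x)"
    using assms unfolding sos_concave_def by (elim exE conjE) (rule that)
  have "form_cone b (\<lambda>x v. \<Sum>l<r. (\<Sum>i\<in>UNIV. W l i x * v $ i)\<^sup>2)"
    using W(1) by (intro form_cone_sum form_cone.square) auto
  moreover have "(\<Sum>l<r. (\<Sum>i\<in>UNIV. W l i x * v $ i)\<^sup>2) = - (v \<bullet> (hessian g x *v v))" for x v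
  proof -
    have h: "hessian g x $ i $ j = - (\<Sum>l<r. W l i x * W l j x)" for i j
      using arg_cong[OF W(2)[rule_format, of x], of "\<lambda>A. A $ i $ j"] by simp
    have "- (v \<bullet> (hessian g x *v v)) = (\<Sum>i\<in>UNIV. \<Sum>j\<in>UNIV. \<Sum>l<r. (W l i x * v $ i) * (W l j x * v $ j))"
      unfolding inner_matrix_vector h by (simp add: sum_negf sum_distrib_left mult_ac)
    also have "\<dots> = (\<Sum>i\<in>UNIV. \<Sum>l<r. \<Sum>j\<in>UNIV. (W l i x * v $ i) * (W l j x * v $ j))"
      by (intro sum.cong refl sum.swap)
    also have "\<dots> = (\<Sum>l<r. \<Sum>i\<in>UNIV. \<Sum>j\<in>UNIV. (W l i x * v $ i) * (W l j x * v $ j))"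
      by (rule sum.swap)
    also have "\<dots> = (\<Sum>l<r. (\<Sum>i\<in>UNIV. W l i x * v $ i)\<^sup>2)"
      by (simp only: power2_eq_square sum_product)
    finally show ?thesis ..
  qed
  ultimately show ?thesis by simp
qed

text \<open>Eliminating one variable at a time gives explicit squares and avoids eigenvalues;
  positive definiteness passes to the reduced form.\<close>

lemma posdef_sum_squares:
  fixes A :: "'i \<Rightarrow> 'i \<Rightarrow> real"
  assumes "finite S" "\<And>i j. A i j = A j i"
    and "\<And>v. \<exists>i\<in>S. v i \<noteq> 0 \<Longrightarrow> 0 < (\<Sum>i\<in>S. \<Sum>j\<in>S. A i j * v i * v j)"
  shows "\<exists>l. \<forall>v. (\<Sum>i\<in>S. \<Sum>j\<in>S. A i j * v i * v j) = (\<Sum>k\<in>S. (\<Sum>i\<in>S. l k i * v i)\<^sup>2)"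
  using assms
proof (induction S arbitrary: A rule: finite_induct)
  case (insert s S)
  note sym = insert.prems(1) and pos = insert.prems(2)
  define a where "a = A s s"
  define lin where "lin v = (\<Sum>j\<in>S. A s j * v j)" for v
  \<comment> \<open>The Schur complement of the diagonal entry \<open>a\<close>.\<close>
  define A' where "A' i j = A i j - A s i * A s j / a" for i j
  have lin_cong: "lin v = lin w" if "\<And>i. i \<in> S \<Longrightarrow> v i = w i" for v w
    unfolding lin_def using that by (intro sum.cong) auto
  have full: "(\<Sum>i\<in>insert s S. \<Sum>j\<in>insert s S. A i j * v i * v j)
      = a * (v s)\<^sup>2 + 2 * v s * lin v + (\<Sum>i\<in>S. \<Sum>j\<in>S. A i j * v i * v j)" for v
  proof -
    have "(\<Sum>i\<in>S. A i s * v i * v s) = v s * lin v"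
      unfolding lin_def sum_distrib_left by (intro sum.cong refl) (simp add: sym[of s])
    moreover have "(\<Sum>j\<in>S. A s j * v s * v j) = v s * lin v"
      unfolding lin_def sum_distrib_left by (intro sum.cong refl) simp
    ultimately show ?thesis
      using insert.hyps by (simp add: sum.distrib a_def power2_eq_square)
  qed
  have "0 < (\<Sum>i\<in>insert s S. \<Sum>j\<in>insert s S. A i j * (if i = s then 1 else 0) * (if j = s then 1 else 0))"
    by (rule pos) auto
  also have "\<dots> = a"
    using insert.hyps unfolding full[of "\<lambda>i. if i = s then 1 else 0"]
    by (subst lin_cong[of _ "\<lambda>_. 0"]) (auto simp: lin_def intro!: sum.neutral)
  finally have a: "0 < a" .
  have rest: "(\<Sum>i\<in>S. \<Sum>j\<in>S. A' i j * v i * v j)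
      = (\<Sum>i\<in>S. \<Sum>j\<in>S. A i j * v i * v j) - (lin v)\<^sup>2 / a" for v
    unfolding A'_def lin_def power2_eq_square sum_product sum_divide_distrib sum_subtractf[symmetric]
    by (intro sum.cong refl) (simp add: algebra_simps)
  \<comment> \<open>Lagrange's completion of the square in the variable \<open>v s\<close>\<close>
  have split: "(\<Sum>i\<in>insert s S. \<Sum>j\<in>insert s S. A i j * v i * v j)
      = (sqrt a * v s + lin v / sqrt a)\<^sup>2 + (\<Sum>i\<in>S. \<Sum>j\<in>S. A' i j * v i * v j)" for v
    unfolding full rest using a by (simp add: power2_sum power_mult_distrib power_divide)
  have "\<exists>l. \<forall>v. (\<Sum>i\<in>S. \<Sum>j\<in>S. A' i j * v i * v j) = (\<Sum>k\<in>S. (\<Sum>i\<in>S. l k i * v i)\<^sup>2)"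
  proof (rule insert.IH)
    show "A' i j = A' j i" for i j using sym[of i j] by (simp add: A'_def mult.commute)
    fix v :: "'i \<Rightarrow> real" assume v: "\<exists>i\<in>S. v i \<noteq> 0"
    \<comment> \<open>The value at \<open>s\<close> makes the completed square vanish, so the full
      form at \<open>w\<close> equals the reduced form at \<open>v\<close>.\<close>
    define w where "w = v(s := - lin v / a)"
    have ws: "w i = v i" if "i \<in> S" for i using that insert.hyps by (auto simp: w_def)
    have lw: "lin w = lin v" by (rule lin_cong) (rule ws)
    have "0 < (\<Sum>i\<in>insert s S. \<Sum>j\<in>insert s S. A i j * w i * w j)"
      using v ws by (intro pos) force
    also have "\<dots> = (sqrt a * w s + lin w / sqrt a)\<^sup>2 + (\<Sum>i\<in>S. \<Sum>j\<in>S. A' i j * w i * w j)"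
      by (rule split)
    also have "sqrt a * w s + lin w / sqrt a = 0"
      using a unfolding lw by (simp add: w_def field_simps)
    also have "(\<Sum>i\<in>S. \<Sum>j\<in>S. A' i j * w i * w j) = (\<Sum>i\<in>S. \<Sum>j\<in>S. A' i j * v i * v j)"
      by (intro sum.cong refl) (simp add: ws)
    finally show "0 < (\<Sum>i\<in>S. \<Sum>j\<in>S. A' i j * v i * v j)" by simp
  qed
  then obtain l where l: "\<And>v. (\<Sum>i\<in>S. \<Sum>j\<in>S. A' i j * v i * v j) = (\<Sum>k\<in>S. (\<Sum>i\<in>S. l k i * v i)\<^sup>2)"
    by blast
  \<comment> \<open>Row \<open>s\<close> is the linear form of the square just split off; the other
    rows ignore the variable \<open>v s\<close>.\<close>
  define l' where "l' k i = (if k = s then (if i = s then sqrt a else A s i / sqrt a) else if i = s then 0 else l k i)"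
    for k i
  have "(\<Sum>k\<in>insert s S. (\<Sum>i\<in>insert s S. l' k i * v i)\<^sup>2)
      = (sqrt a * v s + lin v / sqrt a)\<^sup>2 + (\<Sum>k\<in>S. (\<Sum>i\<in>S. l k i * v i)\<^sup>2)" for v
  proof -
    have "(\<Sum>i\<in>S. l' s i * v i) = lin v / sqrt a"
      unfolding lin_def sum_divide_distrib using insert.hyps
      by (intro sum.cong refl) (auto simp: l'_def)
    moreover have "(\<Sum>i\<in>insert s S. l' k i * v i) = (\<Sum>i\<in>S. l k i * v i)" if "k \<in> S" for k
      using that insert.hyps by (auto simp: l'_def intro!: sum.cong)
    ultimately show ?thesis using insert.hyps by (simp add: l'_def[of s s] cong: sum.cong)
  qed
  then have "\<forall>v. (\<Sum>i\<in>insert s S. \<Sum>j\<in>insert s S. A i j * v i * v j)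
      = (\<Sum>k\<in>insert s S. (\<Sum>i\<in>insert s S. l' k i * v i)\<^sup>2)"
    unfolding split l by simp
  then show ?case by (intro exI[of _ l'])
qed simp

lemma quadratic_form_lower_bound:
  fixes A :: "real ^ 'n ^ 'n"
  assumes "\<And>v. v \<noteq> 0 \<Longrightarrow> 0 < v \<bullet> (A *v v)"
  shows "\<exists>m>0. \<forall>v. m * (norm v)\<^sup>2 \<le> v \<bullet> (A *v v)"
proof -
  have "continuous_on (sphere 0 1) (\<lambda>v. v \<bullet> (A *v v))"
    by (intro continuous_intros linear_continuous_on linear_linear[THEN iffD2] matrix_vector_mul_linear)
  moreover have "axis undefined 1 \<in> sphere (0::real^'n) 1" by (simp add: norm_axis_1)
  ultimately obtain w where w: "norm w = 1" "\<And>v. norm v = 1 \<Longrightarrow> w \<bullet> (A *v w) \<le> v \<bullet> (A *v v)"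
    using continuous_attains_inf[of "sphere (0::real^'n) 1" "\<lambda>v. v \<bullet> (A *v v)"] by auto
  have "(w \<bullet> (A *v w)) * (norm v)\<^sup>2 \<le> v \<bullet> (A *v v)" for v
  proof (cases "v = 0")
    case False
    define e where "e = (1 / norm v) *\<^sub>R v"
    have v: "v = norm v *\<^sub>R e" using False by (simp add: e_def)
    have "w \<bullet> (A *v w) \<le> e \<bullet> (A *v e)" using False by (intro w) (simp add: e_def)
    then have "(w \<bullet> (A *v w)) * (norm v)\<^sup>2 \<le> (e \<bullet> (A *v e)) * (norm v)\<^sup>2"
      by (intro mult_right_mono) auto
    also have "\<dots> = (norm v *\<^sub>R e) \<bullet> (A *v (norm v *\<^sub>R e))"
      by (simp add: matrix_vector_mult_scaleR power2_eq_square)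
    also have "\<dots> = v \<bullet> (A *v v)" by (simp only: v[symmetric])
    finally show ?thesis .
  qed simp
  moreover have "0 < w \<bullet> (A *v w)" using w(1) by (intro assms) auto
  ultimately show ?thesis by blast
qed

text \<open>Some definiteness at \<open>u\<close> is set aside as \<eta> n |v|^2 to absorb the
  change E of the Hessian. Entry by entry this is (\<eta>/2)(v_i^2 + v_j^2) + E_ij v_i v_j =
  (1/4)(\<eta> + E_ij)(v_i + v_j)^2 + (1/4)(\<eta> - E_ij)(v_i - v_j)^2, whose coefficients lie in
  the quadratic module on small balls. What remains is a constant positive definite form.\<close>

lemma form_cone_negative_definite:
  fixes g :: "real ^ 'n \<Rightarrow> real"
  assumes g: "real_polynomial_function g"
    and neg: "\<And>v. v \<noteq> 0 \<Longrightarrow> v \<bullet> (hessian g u *v v) < 0"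
  shows "\<forall>\<^sub>F d in at_right 0. form_cone (ball_poly u d) (\<lambda>x v. - (v \<bullet> (hessian g x *v v)))"
proof -
  define Q where "Q x i j = - hessian g x $ i $ j" for x i j
  have Q: "- (v \<bullet> (hessian g x *v v)) = (\<Sum>i\<in>UNIV. \<Sum>j\<in>UNIV. Q x i j * v $ i * v $ j)" for x v
    unfolding inner_matrix_vector Q_def by (simp add: sum_negf)
  obtain m where m: "0 < m" "\<And>v. m * (norm v)\<^sup>2 \<le> - (v \<bullet> (hessian g u *v v))"
  proof -
    have "(- hessian g u) *v v = - (hessian g u *v v)" for v
      by (simp add: matrix_vector_mult_def vec_eq_iff sum_negf)
    then show ?thesis
      using quadratic_form_lower_bound[of "- hessian g u"] neg that by auto
  qed
  define n where "n = real CARD('n)"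
  have n: "0 < n" by (simp add: n_def)
  \<comment> \<open>Then \<eta> n = m/2, half of the lower bound \<open>m\<close>, and the form
    stays positive definite after the subtraction.\<close>
  define \<eta> where "\<eta> = m / (2 * n)"
  have \<eta>: "0 < \<eta>" using m n by (simp add: \<eta>_def)
  define A where "A i j = (Q u i j + Q u j i) / 2 - (if i = j then \<eta> * n else 0)" for i j
  have A: "(\<Sum>i\<in>UNIV. \<Sum>j\<in>UNIV. A i j * v i * v j)
      = (\<Sum>i\<in>UNIV. \<Sum>j\<in>UNIV. Q u i j * v i * v j) - \<eta> * n * (\<Sum>i\<in>UNIV. (v i)\<^sup>2)" for v
  proof -
    have "A i j * v i * v j = (1/2) * (Q u i j * v i * v j) + (1/2) * (Q u j i * v j * v i)
        - (if j = i then \<eta> * n * (v j)\<^sup>2 else 0)" for i j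
      by (simp add: A_def field_simps power2_eq_square)
    then have "(\<Sum>i\<in>UNIV. \<Sum>j\<in>UNIV. A i j * v i * v j)
        = (1/2) * (\<Sum>i\<in>UNIV. \<Sum>j\<in>UNIV. Q u i j * v i * v j)
        + (1/2) * (\<Sum>i\<in>UNIV. \<Sum>j\<in>UNIV. Q u j i * v j * v i) - \<eta> * n * (\<Sum>i\<in>UNIV. (v i)\<^sup>2)"
      by (simp add: sum.distrib sum_subtractf sum_distrib_left)
    also have "(\<Sum>i\<in>UNIV. \<Sum>j\<in>UNIV. Q u j i * v j * v i) = (\<Sum>i\<in>UNIV. \<Sum>j\<in>UNIV. Q u i j * v i * v j)"
      by (rule sum.swap)
    finally show ?thesis by simp
  qed
  have "\<exists>l. \<forall>v. (\<Sum>i\<in>UNIV. \<Sum>j\<in>UNIV. A i j * v i * v j) = (\<Sum>k\<in>(UNIV :: 'n set). (\<Sum>i\<in>UNIV. l k i * v i)\<^sup>2)"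
  proof (rule posdef_sum_squares)
    show "A i j = A j i" for i j by (simp add: A_def)
    fix v :: "'n \<Rightarrow> real" assume "\<exists>i\<in>UNIV. v i \<noteq> 0"
    then obtain i where i: "v i \<noteq> 0" by blast
    define w where "w = (\<chi> i. v i)"
    have "w \<noteq> 0" using i by (auto simp: w_def vec_eq_iff)
    then have "\<eta> * n * (norm w)\<^sup>2 < m * (norm w)\<^sup>2" using m(1) n by (simp add: \<eta>_def)
    also have "\<dots> \<le> - (w \<bullet> (hessian g u *v w))" by (rule m(2))
    finally show "0 < (\<Sum>i\<in>UNIV. \<Sum>j\<in>UNIV. A i j * v i * v j)"
      unfolding A Q norm_sq_eq_sum by (simp add: w_def)
  qed simp
  then obtain l where l: "\<And>v. (\<Sum>i\<in>UNIV. \<Sum>j\<in>UNIV. A i j * v i * v j) = (\<Sum>k\<in>(UNIV :: 'n set). (\<Sum>i\<in>UNIV. l k i * v i)\<^sup>2)"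
    by blast
  define E where "E i j x = Q x i j - Q u i j" for i j x
  have small: "small_at u (E i j)" for i j
    using small_at_minus[OF small_at_polynomial[OF real_polynomial_function_hessian[OF g, of i j], of u]]
    by (simp add: E_def[abs_def] Q_def)
  have "\<forall>\<^sub>F d in at_right 0. \<forall>i j. quadratic_module (ball_poly u d) (\<lambda>x. \<eta> + E i j x) \<and>
      quadratic_module (ball_poly u d) (\<lambda>x. \<eta> - E i j x)"
    by (intro eventually_all_finite small[unfolded small_at_def, rule_format] \<eta>)
  then show ?thesis
  proof eventually_elim
    case (elim d)
    \<comment> \<open>Coefficients of the linear form v_i + \<sigma> v_j. The two indicators add up
      when i = j, so diagonal entries need no separate treatment.\<close>
    define s where "s \<sigma> i j k = (if k = i then 1 else 0) + \<sigma> * (if k = j then 1 else 0::real)"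
      for \<sigma> and i j k :: 'n
    have s: "(\<Sum>k\<in>UNIV. s \<sigma> i j k * v $ k) = v $ i + \<sigma> * v $ j" for \<sigma> i j and v :: "real^'n"
      by (simp add: s_def distrib_right sum.distrib sum_distrib_left[symmetric] mult.assoc if_distrib[of "\<lambda>t. t * _"] cong: if_cong)
    have "form_cone (ball_poly u d) (\<lambda>x v.
        (\<Sum>k\<in>UNIV. (\<Sum>i\<in>UNIV. l k i * v $ i)\<^sup>2) +
        (\<Sum>i\<in>UNIV. \<Sum>j\<in>UNIV. (1/4 * (\<eta> + E i j x)) * (\<Sum>k\<in>UNIV. s 1 i j k * v $ k)\<^sup>2
           + (1/4 * (\<eta> - E i j x)) * (\<Sum>k\<in>UNIV. s (-1) i j k * v $ k)\<^sup>2))"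
      using elim
      by (intro form_cone.sum form_cone_sum form_cone.square form_cone_mult quadratic_module_scale
          real_polynomial_function.intros(2)) auto
    moreover have "(\<Sum>k\<in>UNIV. (\<Sum>i\<in>UNIV. l k i * v $ i)\<^sup>2) +
        (\<Sum>i\<in>UNIV. \<Sum>j\<in>UNIV. (1/4 * (\<eta> + E i j x)) * (\<Sum>k\<in>UNIV. s 1 i j k * v $ k)\<^sup>2
           + (1/4 * (\<eta> - E i j x)) * (\<Sum>k\<in>UNIV. s (-1) i j k * v $ k)\<^sup>2)
        = - (v \<bullet> (hessian g x *v v))" for x v
    proof -
      have "(1/4 * (\<eta> + E i j x)) * (v $ i + 1 * v $ j)\<^sup>2 + (1/4 * (\<eta> - E i j x)) * (v $ i + (-1) * v $ j)\<^sup>2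
          = (\<eta>/2) * (v $ i)\<^sup>2 + (\<eta>/2) * (v $ j)\<^sup>2 + (Q x i j * v $ i * v $ j - Q u i j * v $ i * v $ j)" for i j
        by (simp add: E_def power2_eq_square field_simps)
      then have "(\<Sum>i\<in>UNIV. \<Sum>j\<in>UNIV. (1/4 * (\<eta> + E i j x)) * (\<Sum>k\<in>UNIV. s 1 i j k * v $ k)\<^sup>2
           + (1/4 * (\<eta> - E i j x)) * (\<Sum>k\<in>UNIV. s (-1) i j k * v $ k)\<^sup>2)
         = (\<Sum>i\<in>UNIV. \<Sum>j\<in>UNIV. (\<eta>/2) * (v $ i)\<^sup>2 + (\<eta>/2) * (v $ j)\<^sup>2 + (Q x i j * v $ i * v $ j - Q u i j * v $ i * v $ j))"
        by (simp only: s)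
      also have "\<dots> = \<eta> * n * (\<Sum>i\<in>UNIV. (v $ i)\<^sup>2) + ((\<Sum>i\<in>UNIV. \<Sum>j\<in>UNIV. Q x i j * v $ i * v $ j)
           - (\<Sum>i\<in>UNIV. \<Sum>j\<in>UNIV. Q u i j * v $ i * v $ j))"
      proof -
        have "(\<Sum>i\<in>UNIV. \<Sum>j\<in>(UNIV :: 'n set). (\<eta>/2) * (v $ i)\<^sup>2) = (\<eta> * n / 2) * (\<Sum>i\<in>UNIV. (v $ i)\<^sup>2)"
          "(\<Sum>i\<in>(UNIV :: 'n set). \<Sum>j\<in>UNIV. (\<eta>/2) * (v $ j)\<^sup>2) = (\<eta> * n / 2) * (\<Sum>i\<in>UNIV. (v $ i)\<^sup>2)"
          by (simp_all add: n_def sum_distrib_left mult_ac)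
        then show ?thesis by (simp only: sum.distrib sum_subtractf) simp
      qed
      finally show ?thesis
        unfolding Q l[symmetric] A by simp
    qed
    ultimately show ?case by simp
  qed
qed

text \<open>Finsler's lemma: subtracting a large multiple of \<open>f\<^sup>2\<close> makes the Hessian negative definite.\<close>

lemma strictly_quasi_concave_penalty:
  fixes f :: "real ^ 'n \<Rightarrow> real"
  assumes "strictly_quasi_concave_at f u"
  shows "\<exists>c\<ge>0. \<forall>v. v \<noteq> 0 \<longrightarrow> v \<bullet> (hessian f u *v v) - c * (gradient f u \<bullet> v)\<^sup>2 < 0"
proof -
  let ?q = "\<lambda>v. v \<bullet> (hessian f u *v v)"
  let ?h = "\<lambda>v. (gradient f u \<bullet> v)\<^sup>2"
  have cont: "continuous_on S ?q" "continuous_on S ?h" for S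
    by (intro continuous_intros linear_continuous_on linear_linear[THEN iffD2] matrix_vector_mul_linear)+
  have sq: "?q v < 0" if "v \<noteq> 0" "gradient f u \<bullet> v = 0" for v
    using assms that unfolding strictly_quasi_concave_at_def by force
  \<comment> \<open>These are the only unit directions that need the penalty. On the compact set
    \<open>K\<close> the gradient term cannot vanish, by strict quasi-concavity, and is therefore
    bounded away from 0.\<close>
  define K where "K = sphere 0 1 \<inter> ?q -` {0..}"
  have K: "compact K"
    unfolding K_def by (intro compact_Int_closed compact_sphere closed_vimage closed_atLeast) (use cont in auto)
  have "\<exists>c\<ge>0. \<forall>v. norm v = 1 \<longrightarrow> ?q v - c * ?h v < 0"
  proof (cases "K = {}")
    case True
    then have "?q v < 0" if "norm v = 1" for v using that by (auto simp: K_def not_le)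
    then show ?thesis by (intro exI[of _ 0]) simp
  next
    case False
    obtain w where w: "w \<in> K" "\<And>v. v \<in> K \<Longrightarrow> ?h w \<le> ?h v"
      using continuous_attains_inf[OF K False cont(2)] by blast
    obtain y where y: "\<And>v. v \<in> K \<Longrightarrow> ?q v \<le> ?q y" "y \<in> K"
      using continuous_attains_sup[OF K False cont(1)] by blast
    have hw: "0 < ?h w"
    proof -
      have "w \<noteq> 0" "0 \<le> ?q w" using w(1) by (auto simp: K_def)
      then have "gradient f u \<bullet> w \<noteq> 0" using sq[of w] by linarith
      then show ?thesis by simp
    qed
    \<comment> \<open>On \<open>K\<close> the penalty c (gradient f u \<bullet> v)^2 is then at
      least the maximum of the Hessian form plus 1; the extra 1 gives strictness.\<close>
    define c where "c = (?q y + 1) / ?h w"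
    have qy: "0 \<le> ?q y" using y(2) by (auto simp: K_def)
    have c: "0 \<le> c" using qy hw by (simp add: c_def)
    have "?q v - c * ?h v < 0" if v: "norm v = 1" for v
    proof (cases "v \<in> K")
      case True
      have "?q v < c * ?h w" using y(1)[OF True] hw by (simp add: c_def)
      also have "\<dots> \<le> c * ?h v" using w(2)[OF True] c by (rule mult_left_mono)
      finally show ?thesis by simp
    next
      case False
      then have "?q v < 0" using v by (auto simp: K_def not_le)
      moreover have "0 \<le> c * ?h v" using c by simp
      ultimately show ?thesis by linarith
    qed
    then show ?thesis using c by blast
  qed
  then obtain c where c: "0 \<le> c" "\<And>v. norm v = 1 \<Longrightarrow> ?q v - c * ?h v < 0" by blast
  have "?q v - c * ?h v < 0" if v: "v \<noteq> 0" for v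
  proof -
    define e where "e = (1 / norm v) *\<^sub>R v"
    have ve: "v = norm v *\<^sub>R e" using v by (simp add: e_def)
    have "norm e = 1" using v by (simp add: e_def)
    then have "(norm v)\<^sup>2 * (?q e - c * ?h e) < 0"
      using c(2) v by (simp add: mult_less_0_iff)
    also have "(norm v)\<^sup>2 * (?q e - c * ?h e) = ?q (norm v *\<^sub>R e) - c * ?h (norm v *\<^sub>R e)"
      by (simp add: matrix_vector_mult_scaleR power_mult_distrib power2_eq_square algebra_simps)
    finally show ?thesis by (simp only: ve[symmetric])
  qed
  then show ?thesis using c(1) by blast
qed

section \<open>Replacing a constraint near a boundary point by one that satisfies Jensen's
  inequality\<close>

lemma eventually_at_right_cball:
  fixes u :: "'a::metric_space"
  assumes "\<forall>\<^sub>F x in nhds u. P x"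
  shows "\<forall>\<^sub>F d in at_right 0. \<forall>x\<in>cball u d. P x"
proof -
  obtain e where e: "0 < e" "\<And>x. dist x u < e \<Longrightarrow> P x"
    using assms unfolding eventually_nhds_metric by blast
  show ?thesis
    unfolding eventually_at_right_field
    by (intro exI[of _ e]) (use e in \<open>auto simp: dist_commute\<close>)
qed

lemma eventually_nhds_polynomial_less:
  fixes f :: "real ^ 'n \<Rightarrow> real"
  assumes "real_polynomial_function f"
  shows "f u < c \<Longrightarrow> \<forall>\<^sub>F x in nhds u. f x < c" and "c < f u \<Longrightarrow> \<forall>\<^sub>F x in nhds u. c < f x"
proof -
  have "isCont f u"
    using real_polynomial_function_gradient(1)[OF assms] by (rule has_derivative_continuous)
  then have "(f \<longlongrightarrow> f u) (nhds u)"
    by (simp add: continuous_at tendsto_nhds_iff)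
  then show "f u < c \<Longrightarrow> \<forall>\<^sub>F x in nhds u. f x < c" "c < f u \<Longrightarrow> \<forall>\<^sub>F x in nhds u. c < f x"
    by (auto dest: order_tendstoD)
qed

lemma jensen_at_const: "jensen_at N b (\<lambda>x. c)"
  unfolding jensen_at_def by (simp add: sum_distrib_right[symmetric])

text \<open>Where f(u) \<noteq> 0 the sign of \<open>f\<close> is locally constant, and a constant
  of that sign, for which Jensen's inequality is trivial, can replace it. Concavity is therefore
  called upon only for constraints that vanish at \<open>u\<close>.\<close>

lemma local_jensen_superlevel:
  fixes f :: "real ^ 'n \<Rightarrow> real"
  assumes f: "real_polynomial_function f"
    and conc: "f u = 0 \<Longrightarrow> sos_concave f \<or> strictly_quasi_concave_at f u"
  shows "\<exists>g. real_polynomial_function g \<and> (\<forall>\<^sub>F d in at_right 0.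
      (\<exists>N. jensen_at N (ball_poly u d) g) \<and> (\<forall>x\<in>cball u d. 0 \<le> g x \<longleftrightarrow> 0 \<le> f x))"
proof -
  consider "f u < 0" | "0 < f u" | "sos_concave f" | "f u = 0" "strictly_quasi_concave_at f u"
    using conc by fastforce
  then show ?thesis
  proof cases
    case 1
    show ?thesis
    proof (intro exI[of _ "\<lambda>x. -1"] conjI real_polynomial_function.intros(2))
      show "\<forall>\<^sub>F d in at_right 0. (\<exists>N. jensen_at N (ball_poly u d) (\<lambda>x. - 1)) \<and>
          (\<forall>x\<in>cball u d. (0::real) \<le> - 1 \<longleftrightarrow> 0 \<le> f x)"
        using eventually_at_right_cball[OF eventually_nhds_polynomial_less(1)[OF f 1]]
        by eventually_elim (use jensen_at_const in force)
    qed
  next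
    case 2
    show ?thesis
    proof (intro exI[of _ "\<lambda>x. 1"] conjI real_polynomial_function.intros(2))
      show "\<forall>\<^sub>F d in at_right 0. (\<exists>N. jensen_at N (ball_poly u d) (\<lambda>x. 1)) \<and>
          (\<forall>x\<in>cball u d. (0::real) \<le> 1 \<longleftrightarrow> 0 \<le> f x)"
        using eventually_at_right_cball[OF eventually_nhds_polynomial_less(2)[OF f 2]]
        by eventually_elim (use jensen_at_const in force)
    qed
  next
    case 3
    then show ?thesis
      using jensen_at_form_cone[OF f form_cone_sos_concave[OF 3]] f
      by (intro exI[of _ f]) simp
  next
    case 4
    obtain c where c: "0 \<le> c" "\<And>v. v \<noteq> 0 \<Longrightarrow> v \<bullet> (hessian f u *v v) - c * (gradient f u \<bullet> v)\<^sup>2 < 0"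
      using strictly_quasi_concave_penalty[OF 4(2)] by blast
    \<comment> \<open>The factor 1/2 cancels the 2 in the Hessian of f^2 at a zero, which is twice
      the outer square of the gradient. Moreover g = f (1 - (c/2) f), so the signs agree as long as
      (c/2) f < 1.\<close>
    define g where "g x = f x - (c/2) * (f x * f x)" for x
    have g: "real_polynomial_function g"
      unfolding g_def[abs_def]
      by (intro real_polynomial_function_diff real_polynomial_function.intros(4) f real_polynomial_function.intros(2))
    have "gradient g x = (1 - c * f x) *\<^sub>R gradient f x" for x
    proof (rule gradient_eq)
      show "(g has_derivative (\<lambda>v. ((1 - c * f x) *\<^sub>R gradient f x) \<bullet> v)) (at x)"
        unfolding g_def[abs_def]
        by (auto intro!: derivative_eq_intros real_polynomial_function_gradient(1)[OF f] simp: algebra_simps)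
    qed
    then have grad: "gradient g = (\<lambda>x. (1 - c * f x) *\<^sub>R gradient f x)" by (rule ext)
    have "(gradient g has_derivative (\<lambda>v. hessian f u *v v - (c * (gradient f u \<bullet> v)) *\<^sub>R gradient f u)) (at u)"
      unfolding grad
      by (auto intro!: derivative_eq_intros real_polynomial_function_gradient(1)[OF f] has_derivative_hessian[OF f]
          simp: 4(1))
    then have hess: "hessian g u *v v = hessian f u *v v - (c * (gradient f u \<bullet> v)) *\<^sub>R gradient f u" for v
      by (rule hessian_eqI[OF g])
    have neg: "v \<bullet> (hessian g u *v v) < 0" if "v \<noteq> 0" for v
      using c(2)[OF that] unfolding hess
      by (simp add: inner_diff_right inner_commute power2_eq_square mult.assoc)
    have "\<forall>\<^sub>F d in at_right 0. form_cone (ball_poly u d) (\<lambda>x v. - (v \<bullet> (hessian g x *v v)))"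
      by (rule form_cone_negative_definite[OF g]) (rule neg)
    then have ev1: "\<forall>\<^sub>F d in at_right 0. \<exists>N. jensen_at N (ball_poly u d) g"
      by eventually_elim (rule jensen_at_form_cone[OF g])
    have "\<forall>\<^sub>F x in nhds u. (c/2) * f x < 1"
      by (rule eventually_nhds_polynomial_less(1)[OF real_polynomial_function.intros(4)[OF
            real_polynomial_function.intros(2) f]]) (simp add: 4(1))
    then have "\<forall>\<^sub>F x in nhds u. 0 \<le> g x \<longleftrightarrow> 0 \<le> f x"
    proof eventually_elim
      case (elim x)
      have "g x = f x * (1 - (c/2) * f x)" by (simp add: g_def algebra_simps)
      then show ?case using elim by (simp add: zero_le_mult_iff)
    qed
    from eventually_conj[OF ev1 eventually_at_right_cball[OF this]] show ?thesis using g by blast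
  qed
qed

section \<open>The convex hull of finitely many localized cells\<close>

lemma moment_psd_linear:
  fixes w :: "real ^ 'n \<Rightarrow> real"
  assumes "moment_psd N w X c" "moment_psd N w X c'" "0 \<le> s" "0 \<le> t"
  shows "moment_psd N w X (\<lambda>x. s * c x + t * c' x)"
  unfolding moment_psd_def
proof
  fix p :: "real ^ 'n \<Rightarrow> real" assume p: "p \<in> poly_le N"
  have "(\<Sum>x\<in>X. (s * c x + t * c' x) * w x * (p x)\<^sup>2)
      = s * (\<Sum>x\<in>X. c x * w x * (p x)\<^sup>2) + t * (\<Sum>x\<in>X. c' x * w x * (p x)\<^sup>2)"
    by (simp add: sum_distrib_left sum.distrib distrib_right mult.assoc)
  also have "\<dots> \<ge> 0"
    using assms p unfolding moment_psd_def by simp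
  finally show "0 \<le> (\<Sum>x\<in>X. (s * c x + t * c' x) * w x * (p x)\<^sup>2)" .
qed

text \<open>Quantification over polynomials becomes quantification over finite coefficient vectors,
  as needed for a matrix inequality.\<close>

lemma moment_psd_iff_monomials:
  fixes w :: "real ^ 'n \<Rightarrow> real"
  shows "moment_psd N w X c \<longleftrightarrow>
    (\<forall>z. 0 \<le> (\<Sum>x\<in>X. c x * w x * (\<Sum>js\<in>monomials N. z js * monomial js x)\<^sup>2))"
proof
  assume m: "moment_psd N w X c"
  show "\<forall>z. 0 \<le> (\<Sum>x\<in>X. c x * w x * (\<Sum>js\<in>monomials N. z js * monomial js x)\<^sup>2)"
  proof
    fix z :: "'n option list \<Rightarrow> real"
    have "(\<lambda>x. \<Sum>js\<in>monomials N. z js * monomial js x) \<in> poly_le N"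
      by (intro poly_le_sum poly_le_scale monomial_poly_le finite_monomials)
    then show "0 \<le> (\<Sum>x\<in>X. c x * w x * (\<Sum>js\<in>monomials N. z js * monomial js x)\<^sup>2)"
      using m[unfolded moment_psd_def] by (rule bspec[rotated])
  qed
next
  assume a: "\<forall>z. 0 \<le> (\<Sum>x\<in>X. c x * w x * (\<Sum>js\<in>monomials N. z js * monomial js x)\<^sup>2)"
  show "moment_psd N w X c"
    unfolding moment_psd_def
  proof
    fix p :: "real ^ 'n \<Rightarrow> real" assume "p \<in> poly_le N"
    then obtain z where z: "\<forall>x. p x = (\<Sum>js\<in>monomials N. z js * monomial js x)"
      using poly_le_monomials by blast
    have "p = (\<lambda>x. \<Sum>js\<in>monomials N. z js * monomial js x)" by (rule ext) (rule z[rule_format])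
    then show "0 \<le> (\<Sum>x\<in>X. c x * w x * (p x)\<^sup>2)" using a[rule_format, of z] by simp
  qed
qed

text \<open>The weights of all cells form a single family on J \<times> X, the lifting variables of
  the final pencil. An indicator in the weight restricts a constraint to block
  \<open>j\<close>.\<close>

lemma sum_Times_fiber:
  fixes c :: "'a \<times> 'b \<Rightarrow> real"
  assumes "finite J" "j \<in> J"
  shows "(\<Sum>k\<in>J \<times> X. c k * (if fst k = j then F (snd k) else 0) * G (snd k)) = (\<Sum>x\<in>X. c (j, x) * F x * G x)"
proof -
  have "(\<Sum>k\<in>J \<times> X. c k * (if fst k = j then F (snd k) else 0) * G (snd k))
      = (\<Sum>i\<in>J. \<Sum>x\<in>X. c (i, x) * (if i = j then F x else 0) * G x)"
    by (simp add: sum.cartesian_product split_beta)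
  also have "\<dots> = (\<Sum>i\<in>J. if i = j then \<Sum>x\<in>X. c (j, x) * F x * G x else 0)"
    by (intro sum.cong refl) auto
  finally show ?thesis using assms by simp
qed

lemma lmi_moment_psd:
  fixes w :: "real ^ 'n \<Rightarrow> real"
  assumes "finite J" "finite X" "j \<in> J"
  shows "lmi (J \<times> X) (\<lambda>(x :: real ^ 'n) c. moment_psd N w X (\<lambda>y. c (j, y)))"
proof -
  have "lmi (J \<times> X) (\<lambda>(x :: real ^ 'n) c. \<forall>z. 0 \<le> (\<Sum>k\<in>J \<times> X. c k *
      (if fst k = j then w (snd k) else 0) * (\<Sum>js\<in>monomials N. z js * monomial js (snd k))\<^sup>2))"
    by (intro lmi_weighted_squares finite_monomials finite_cartesian_product assms)
  then show ?thesis
    by (simp only: moment_psd_iff_monomials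
        sum_Times_fiber[OF assms(1,3), where G="\<lambda>y. (\<Sum>js\<in>monomials N. _ js * monomial js y)\<^sup>2"])
qed

lemma lmi_moment_nonneg:
  assumes "finite J" "finite X" "j \<in> J"
  shows "lmi (J \<times> X) (\<lambda>(x :: real ^ 'n) c. 0 \<le> (\<Sum>y\<in>X. c (j, y) * g y))"
  using lmi_affine[of "J \<times> X" 0 "\<lambda>_. 0" "\<lambda>k. if fst k = j then g (snd k) else 0"]
    sum_Times_fiber[OF assms(1,3), where G="\<lambda>_. 1" and F=g and X=X] by simp

lemma moment_mass_nonneg:
  assumes "moment_psd N (\<lambda>_. 1) X c" shows "0 \<le> (\<Sum>x\<in>X. c x)"
  using assms[unfolded moment_psd_def, rule_format, OF poly_le_const[of 1]] by simp

text \<open>A degenerate Cauchy-Schwarz inequality: applied to (1 + t x_k)^2, the functional gives a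
  nonnegative quadratic in t without constant term, so its linear coefficient vanishes. The bound 1
  \<le> N admits these test polynomials.\<close>

lemma moment_zero_mass:
  fixes X :: "(real ^ 'n) set"
  assumes m: "moment_psd N (\<lambda>_. 1) X c" and N: "1 \<le> N" and zero: "(\<Sum>x\<in>X. c x) = 0"
  shows "(\<Sum>x\<in>X. c x *\<^sub>R x) = 0"
proof -
  have "(\<Sum>x\<in>X. c x * x $ k) = 0" for k
  proof -
    define A where "A = (\<Sum>x\<in>X. c x * (x $ k)\<^sup>2)"
    define B where "B = (\<Sum>x\<in>X. c x * x $ k)"
    have lin: "(\<lambda>x. 1 + t * x $ k) \<in> poly_le N" "(\<lambda>x. x $ k) \<in> poly_le N" for t
      using N by (auto intro!: poly_le_mono[of "Suc 0" N] poly_le_add poly_le_const poly_le_scale poly_le_coord)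
    have A: "0 \<le> A" using m[unfolded moment_psd_def, rule_format, OF lin(2)] by (simp add: A_def)
    have "0 \<le> 2 * t * B + t\<^sup>2 * A" for t
    proof -
      have "0 \<le> (\<Sum>x\<in>X. c x * 1 * (1 + t * x $ k)\<^sup>2)"
        by (rule bspec[OF m[unfolded moment_psd_def] lin(1)[of t]])
      also have "\<dots> = (\<Sum>x\<in>X. c x) + 2 * t * B + t\<^sup>2 * A"
        unfolding A_def B_def sum_distrib_left sum.distrib[symmetric]
        by (intro sum.cong refl) (simp add: power2_eq_square algebra_simps)
      finally show ?thesis using zero by simp
    qed
    \<comment> \<open>Up to sign this is the minimizer B/A, with A + 1 in the denominator because
      \<open>A\<close> may be 0.\<close>
    from this[of "- B / (A + 1)"] have "0 \<le> 2 * (- B / (A + 1)) * B + (- B / (A + 1))\<^sup>2 * A" .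
    also have "\<dots> = - (B\<^sup>2 * (A + 2)) / (A + 1)\<^sup>2"
      using A by (simp add: divide_simps) (simp add: power2_eq_square algebra_simps)
    finally have "B\<^sup>2 * (A + 2) \<le> 0" using A by (simp add: divide_le_0_iff zero_le_divide_iff)
    then show ?thesis using A by (simp add: mult_le_0_iff B_def)
  qed
  then show ?thesis by (simp add: vec_eq_iff)
qed

text \<open>The variance identity: for L of mass one with barycentre a, L(b) = b(a) - L(|x - a|^2).
  The left side is nonnegative by localization, and L(|x - a|^2) is nonnegative as a sum of squares
  of affine functions.\<close>

lemma moment_barycentre_in_ball:
  fixes X :: "(real ^ 'n) set"
  assumes m: "moment_psd N (\<lambda>_. 1) X c" "moment_psd N (ball_poly u d) X c" and N: "1 \<le> N"
    and one: "(\<Sum>x\<in>X. c x) = 1"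
  shows "0 \<le> ball_poly u d (\<Sum>x\<in>X. c x *\<^sub>R x)"
proof -
  define a where "a = (\<Sum>x\<in>X. c x *\<^sub>R x)"
  have "0 \<le> (\<Sum>x\<in>X. c x * ball_poly u d x)"
    using m(2)[unfolded moment_psd_def, rule_format, OF poly_le_const[of 1]] by simp
  also have "\<dots> = (\<Sum>x\<in>X. c x * ball_poly u d a - 2 * ((a - u) \<bullet> (c x *\<^sub>R x - c x *\<^sub>R a)) - c x * (norm (x - a))\<^sup>2)"
    by (intro sum.cong refl) (simp add: power2_norm_eq_inner inner_simps inner_commute algebra_simps)
  also have "\<dots> = (\<Sum>x\<in>X. c x) * ball_poly u d a - 2 * ((a - u) \<bullet> ((\<Sum>x\<in>X. c x *\<^sub>R x) - (\<Sum>x\<in>X. c x) *\<^sub>R a))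
      - (\<Sum>x\<in>X. c x * (norm (x - a))\<^sup>2)"
    by (simp only: sum_subtractf sum_distrib_right sum_distrib_left[symmetric] inner_sum_right[symmetric] scaleR_left.sum)
  also have "\<dots> = ball_poly u d a - (\<Sum>x\<in>X. c x * (norm (x - a))\<^sup>2)"
    by (simp add: one a_def)
  finally have "(\<Sum>x\<in>X. c x * (norm (x - a))\<^sup>2) \<le> ball_poly u d a" by simp
  moreover have "0 \<le> (\<Sum>k\<in>UNIV. \<Sum>x\<in>X. c x * ((x - a) $ k)\<^sup>2)"
  proof (rule sum_nonneg)
    fix k
    have "(\<lambda>x. x $ k + (- a $ k)) \<in> poly_le N"
      using N by (intro poly_le_mono[of "Suc 0" N] poly_le_add poly_le_const poly_le_coord) simp
    from m(1)[unfolded moment_psd_def, rule_format, OF this]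
    show "0 \<le> (\<Sum>x\<in>X. c x * ((x - a) $ k)\<^sup>2)" by simp
  qed
  moreover have "(\<Sum>k\<in>UNIV. \<Sum>x\<in>X. c x * ((x - a) $ k)\<^sup>2) = (\<Sum>x\<in>X. c x * (norm (x - a))\<^sup>2)"
    unfolding norm_sq_eq_sum by (subst sum.swap) (simp add: sum_distrib_left)
  ultimately show ?thesis by (simp add: a_def)
qed

lemma finite_uniform_bound:
  fixes Q :: "'a \<Rightarrow> nat \<Rightarrow> bool"
  assumes "finite P" "\<And>p. p \<in> P \<Longrightarrow> \<exists>N. Q p N" "\<And>p N M. Q p N \<Longrightarrow> N \<le> M \<Longrightarrow> Q p M"
  shows "\<exists>N\<ge>k. \<forall>p\<in>P. Q p N"
  using assms(1,2)
proof (induction P rule: finite_induct)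
  case (insert p P)
  then obtain N M where "N \<ge> k" "\<forall>p\<in>P. Q p N" "Q p M" by blast
  then show ?case
    by (intro exI[of _ "max N M"]) (auto intro: assms(3)[of _ N "max N M"] assms(3)[of _ M "max N M"])
qed auto

lemma ball_poly_poly_le: "ball_poly u d \<in> poly_le 2"
proof -
  have l: "(\<lambda>x. x $ k + (- u $ k)) \<in> poly_le (Suc 0)" for k
    by (intro poly_le_add poly_le_const poly_le_coord)
  have "(\<lambda>x. d\<^sup>2 + (-1) * (\<Sum>k\<in>UNIV. (x $ k + (- u $ k)) * (x $ k + (- u $ k)))) \<in> poly_le (Suc 0 + Suc 0)"
    by (intro poly_le_add poly_le_const poly_le_scale poly_le_sum poly_le_mult l) simp
  moreover have "(\<lambda>x. d\<^sup>2 + (-1) * (\<Sum>k\<in>UNIV. (x $ k + (- u $ k)) * (x $ k + (- u $ k)))) = ball_poly u d"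
    unfolding norm_sq_eq_sum by (simp add: power2_eq_square)
  moreover have "Suc 0 + Suc 0 = 2" by simp
  ultimately show ?thesis by (simp only:)
qed

text \<open>Each cell receives its own block of weights, whose mass serves as convex coefficient and
  whose normalized barycentre is the point of the cell. Jensen's inequality puts that barycentre
  into the cell; conversely, points of cells enter through evaluations.\<close>

lemma sdp_representable_hull_cells:
  fixes u :: "'j \<Rightarrow> real ^ 'n" and d :: "'j \<Rightarrow> real" and I :: "'j \<Rightarrow> 'i set"
    and g :: "'j \<Rightarrow> 'i \<Rightarrow> real ^ 'n \<Rightarrow> real"
  assumes J: "finite J" and I: "\<And>j. j \<in> J \<Longrightarrow> finite (I j)" and d: "\<And>j. j \<in> J \<Longrightarrow> 0 \<le> d j"
    and poly: "\<And>j i. j \<in> J \<Longrightarrow> i \<in> I j \<Longrightarrow> real_polynomial_function (g j i)"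
    and jensen: "\<And>j i. j \<in> J \<Longrightarrow> i \<in> I j \<Longrightarrow> \<exists>N. jensen_at N (ball_poly (u j) (d j)) (g j i)"
  shows "sdp_representable (convex hull (\<Union>j\<in>J. {x \<in> cball (u j) (d j). \<forall>i\<in>I j. 0 \<le> g j i x}))"
proof -
  define S where "S j = {x \<in> cball (u j) (d j). \<forall>i\<in>I j. 0 \<le> g j i x}" for j
  let ?b = "\<lambda>j. ball_poly (u j) (d j)"
  have S: "x \<in> S j \<longleftrightarrow> 0 \<le> ?b j x \<and> (\<forall>i\<in>I j. 0 \<le> g j i x)" if "j \<in> J" for x j
  proof -
    have "norm (x - u j) \<le> d j \<longleftrightarrow> 0 \<le> ?b j x"
      using d[OF that] by (simp add: abs_le_square_iff[symmetric])
    then show ?thesis by (simp add: S_def dist_norm norm_minus_commute)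
  qed
  have P: "finite (Sigma J I)" using J I by simp
  \<comment> \<open>The order has to be at least 1 so that affine test polynomials are available for
    zero masses and for the ball constraint.\<close>
  have "\<exists>N\<ge>1. \<forall>p\<in>Sigma J I. jensen_at N (?b (fst p)) (g (fst p) (snd p))"
  proof (rule finite_uniform_bound[OF P])
    show "\<exists>N. jensen_at N (?b (fst p)) (g (fst p) (snd p))" if "p \<in> Sigma J I" for p
      using that by (intro jensen) auto
  qed (rule jensen_at_mono)
  then obtain N where N: "1 \<le> N" "\<forall>p\<in>Sigma J I. jensen_at N (?b (fst p)) (g (fst p) (snd p))"
    by (elim exE conjE) (rule that)
  \<comment> \<open>The largest products tested are the ball polynomial, of degree 2, times the
    square of a polynomial of degree \<open>N\<close>; evaluations must be reproduced on these and
    on the constraints.\<close>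
  have "\<exists>M\<ge>2 + 2 * N. \<forall>p\<in>Sigma J I. g (fst p) (snd p) \<in> poly_le M"
  proof (rule finite_uniform_bound[OF P])
    show "\<exists>M. g (fst p) (snd p) \<in> poly_le M" if "p \<in> Sigma J I" for p
      using that by (intro real_polynomial_function_poly_le poly) auto
  qed (rule poly_le_mono)
  then obtain M where M: "2 + 2 * N \<le> M" "\<forall>p\<in>Sigma J I. g (fst p) (snd p) \<in> poly_le M"
    by (elim exE conjE) (rule that)
  obtain X :: "(real ^ 'n) set" where X: "finite X"
      "\<forall>y. \<exists>e. \<forall>f\<in>poly_le M. f y = (\<Sum>x\<in>X. e x * f x)"
    using poly_le_evaluations_span[of M] by (elim exE conjE) (rule that)
  \<comment> \<open>All conditions are homogeneous in \<open>x\<close> and \<open>c\<close> except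
    that the total mass is one; the masses of the individual blocks stay free.\<close>
  define C where "C x c \<longleftrightarrow> (\<forall>j\<in>J. moment_psd N (\<lambda>_. 1) X (\<lambda>y. c (j, y)) \<and> moment_psd N (?b j) X (\<lambda>y. c (j, y))
      \<and> (\<forall>i\<in>I j. 0 \<le> (\<Sum>y\<in>X. c (j, y) * g j i y)))
      \<and> (-1) + (\<Sum>k\<in>J \<times> X. c k) = 0 \<and> (\<forall>i\<in>UNIV. - x $ i + (\<Sum>k\<in>J \<times> X. c k * snd k $ i) = 0)"
    for x :: "real ^ 'n" and c :: "'j \<times> (real ^ 'n) \<Rightarrow> real"
  define R where "R = {x. \<exists>c. C x c}"
  have "lmi (J \<times> X) C"
  proof -
    have mass: "lmi (J \<times> X) (\<lambda>(x :: real ^ 'n) c. (-1) + (\<Sum>k\<in>J \<times> X. c k) = 0)"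
      using lmi_affine_eq[of "J \<times> X" "-1" "\<lambda>_. 0" "\<lambda>_. 1"] by simp
    have bary: "lmi (J \<times> X) (\<lambda>(x :: real ^ 'n) c. - x $ i + (\<Sum>k\<in>J \<times> X. c k * snd k $ i) = 0)" for i
    proof -
      have "(\<Sum>k\<in>UNIV. x $ k * (if k = i then - 1 else 0)) = - x $ i" for x :: "real ^ 'n"
        by (simp add: if_distrib cong: if_cong)
      then show ?thesis
        using lmi_affine_eq[of "J \<times> X" 0 "\<lambda>k. if k = i then -1 else 0" "\<lambda>k. snd k $ i"] by simp
    qed
    show ?thesis
      unfolding C_def[abs_def]
      by (intro lmi_conj lmi_ball lmi_moment_psd lmi_moment_nonneg mass bary J X(1) I finite)
  qed
  then have "sdp_representable R"
    unfolding R_def by (rule sdp_representable_if_lmi[rotated]) (simp add: J X(1))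
  moreover have "R = convex hull (\<Union>j\<in>J. S j)"
  proof
    show "R \<subseteq> convex hull (\<Union>j\<in>J. S j)"
    proof
      fix x assume "x \<in> R"
      then obtain c where c: "C x c" unfolding R_def by blast
      define mass where "mass j = (\<Sum>y\<in>X. c (j, y))" for j
      define bary where "bary j = (\<Sum>y\<in>X. c (j, y) *\<^sub>R y)" for j
      define J' where "J' = {j \<in> J. 0 < mass j}"
      have m: "moment_psd N (\<lambda>_. 1) X (\<lambda>y. c (j, y))" "moment_psd N (?b j) X (\<lambda>y. c (j, y))"
          "\<And>i. i \<in> I j \<Longrightarrow> 0 \<le> (\<Sum>y\<in>X. c (j, y) * g j i y)" if "j \<in> J" for j
        using c that unfolding C_def by auto
      have mass0: "0 \<le> mass j" if "j \<in> J" for j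
        unfolding mass_def by (rule moment_mass_nonneg[OF m(1)[OF that]])
      have out: "mass j = 0" "bary j = 0" if "j \<in> J - J'" for j
      proof -
        show z: "mass j = 0" using that mass0[of j] by (auto simp: J'_def)
        show "bary j = 0"
          unfolding bary_def using that z by (intro moment_zero_mass[OF m(1) N(1)]) (auto simp: mass_def)
      qed
      have "finite J'" "J' \<subseteq> J" using J by (auto simp: J'_def)
      have "(\<Sum>j\<in>J. mass j) = 1"
        using c by (simp add: C_def mass_def sum.cartesian_product split_beta)
      then have one: "(\<Sum>j\<in>J'. mass j) = 1"
        using sum.mono_neutral_left[OF J \<open>J' \<subseteq> J\<close>, of mass] out by simp
      have "(\<Sum>j\<in>J. bary j) $ i = x $ i" for i
      proof -
        have "(\<Sum>j\<in>J. bary j) $ i = (\<Sum>k\<in>J \<times> X. c k * snd k $ i)"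
          by (simp add: bary_def sum.cartesian_product split_beta)
        then show ?thesis using c by (simp add: C_def)
      qed
      then have "x = (\<Sum>j\<in>J. bary j)" by (simp add: vec_eq_iff)
      also have "\<dots> = (\<Sum>j\<in>J'. bary j)"
        using sum.mono_neutral_left[OF J \<open>J' \<subseteq> J\<close>, of bary] out by simp
      also have "\<dots> = (\<Sum>j\<in>J'. mass j *\<^sub>R ((1 / mass j) *\<^sub>R bary j))"
        by (intro sum.cong refl) (simp add: J'_def)
      also have "\<dots> \<in> convex hull (\<Union>j\<in>J. S j)"
      proof (rule convex_sum[OF \<open>finite J'\<close> convex_convex_hull one])
        fix j assume j: "j \<in> J'"
        then have jJ: "j \<in> J" and pos: "0 < mass j" by (auto simp: J'_def)
        then show "0 \<le> mass j" by simp
        define e where "e y = (1 / mass j) * c (j, y)" for y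
        have sc: "moment_psd N w X e" if "moment_psd N w X (\<lambda>y. c (j, y))" for w
          using moment_psd_linear[OF that that, of "1 / mass j" 0] pos by (simp add: e_def[abs_def])
        have e1: "(\<Sum>y\<in>X. e y) = 1"
          unfolding e_def sum_distrib_left[symmetric] mass_def[symmetric] using pos by simp
        have eb: "(\<Sum>y\<in>X. e y *\<^sub>R y) = (1 / mass j) *\<^sub>R bary j"
          by (simp add: e_def bary_def scaleR_sum_right)
        have b: "0 \<le> ?b j ((1 / mass j) *\<^sub>R bary j)"
          unfolding eb[symmetric] by (rule moment_barycentre_in_ball[OF sc[OF m(1)[OF jJ]] sc[OF m(2)[OF jJ]] N(1) e1])
        have "0 \<le> g j i ((1 / mass j) *\<^sub>R bary j)" if i: "i \<in> I j" for i
        proof -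
          have "jensen_at N (?b j) (g j i)" using bspec[OF N(2), of "(j, i)"] jJ i by simp
          from this[unfolded jensen_at_def, rule_format, OF sc[OF m(1)[OF jJ]] sc[OF m(2)[OF jJ]] e1 eb b]
          have "(\<Sum>y\<in>X. e y * g j i y) \<le> g j i ((1 / mass j) *\<^sub>R bary j)" .
          moreover have "(\<Sum>y\<in>X. e y * g j i y) = (1 / mass j) * (\<Sum>y\<in>X. c (j, y) * g j i y)"
            by (simp add: e_def sum_distrib_left)
          moreover have "0 \<le> (1 / mass j) * (\<Sum>y\<in>X. c (j, y) * g j i y)"
            using m(3)[OF jJ i] pos by simp
          ultimately show ?thesis by linarith
        qed
        with b have "(1 / mass j) *\<^sub>R bary j \<in> S j" using S[OF jJ] by blast
        then show "(1 / mass j) *\<^sub>R bary j \<in> convex hull (\<Union>j\<in>J. S j)"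
          using jJ by (intro hull_inc) blast
      qed
      finally show "x \<in> convex hull (\<Union>j\<in>J. S j)" .
    qed
    show "convex hull (\<Union>j\<in>J. S j) \<subseteq> R"
    \<comment> \<open>Since the conditions are linear in \<open>x\<close> and \<open>c\<close>
      jointly, the projection is convex and only points of single cells remain to be
      checked.\<close>
    proof (rule hull_minimal)
      show "convex R"
      proof (rule convexI)
        fix x y and s t :: real
        assume "x \<in> R" "y \<in> R" and st: "0 \<le> s" "0 \<le> t" "s + t = 1"
        then obtain c c' where c: "C x c" "C y c'" unfolding R_def by blast
        have lin: "(\<Sum>k\<in>K. (s * c (h k) + t * c' (h k)) * F k) = s * (\<Sum>k\<in>K. c (h k) * F k) + t * (\<Sum>k\<in>K. c' (h k) * F k)"
          for K :: "'k set" and F h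
          by (simp add: sum_distrib_left sum.distrib distrib_right mult.assoc)
        have "C (s *\<^sub>R x + t *\<^sub>R y) (\<lambda>k. s * c k + t * c' k)"
          unfolding C_def
        proof (intro conjI ballI)
          fix j assume j: "j \<in> J"
          show "moment_psd N (\<lambda>_. 1) X (\<lambda>y. s * c (j, y) + t * c' (j, y))"
            "moment_psd N (?b j) X (\<lambda>y. s * c (j, y) + t * c' (j, y))"
            using c j st by (auto simp: C_def intro!: moment_psd_linear)
          fix i assume i: "i \<in> I j"
          show "0 \<le> (\<Sum>y\<in>X. (s * c (j, y) + t * c' (j, y)) * g j i y)"
            using c j i st by (simp add: C_def lin)
        next
          show "- 1 + (\<Sum>k\<in>J \<times> X. s * c k + t * c' k) = 0"
            using c st by (simp add: C_def sum.distrib sum_distrib_left[symmetric])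
        next
          fix i
          have "(\<Sum>k\<in>J \<times> X. (s * c k + t * c' k) * snd k $ i)
              = s * (\<Sum>k\<in>J \<times> X. c k * snd k $ i) + t * (\<Sum>k\<in>J \<times> X. c' k * snd k $ i)"
            by (rule lin)
          then show "- (s *\<^sub>R x + t *\<^sub>R y) $ i + (\<Sum>k\<in>J \<times> X. (s * c k + t * c' k) * snd k $ i) = 0"
            using c by (simp add: C_def)
        qed
        then show "s *\<^sub>R x + t *\<^sub>R y \<in> R" unfolding R_def by blast
      qed
      show "(\<Union>j\<in>J. S j) \<subseteq> R"
      proof
        fix y assume "y \<in> (\<Union>j\<in>J. S j)"
        then obtain j where j: "j \<in> J" "y \<in> S j" by blast
        then have y: "0 \<le> ?b j y" "\<And>i. i \<in> I j \<Longrightarrow> 0 \<le> g j i y" using S by blast+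
        obtain e where "\<forall>f\<in>poly_le M. f y = (\<Sum>x\<in>X. e x * f x)"
          using X(2)[rule_format, of y] by (elim exE) (rule that)
        then have e: "(\<Sum>x\<in>X. e x * f x) = f y" if "f \<in> poly_le M" for f
          using that by simp
        \<comment> \<open>Everything is put on block \<open>j\<close>. Although \<open>e\<close> may
          change sign, it reproduces evaluation at \<open>y\<close> up to degree \<open>M\<close>,
          so each test becomes the value at \<open>y\<close> of a function that is nonnegative
          there.\<close>
        define c where "c k = (if fst k = j then e (snd k) else 0)" for k :: "'j \<times> (real ^ 'n)"
        have cj: "c (j, x) = e x" and cn: "j' \<noteq> j \<Longrightarrow> c (j', x) = 0" for x j' by (simp_all add: c_def)
        have tot: "(\<Sum>k\<in>J \<times> X. c k * F (snd k)) = (\<Sum>x\<in>X. e x * F x)" for F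
          using sum_Times_fiber[OF J j(1), of "\<lambda>_. 1" e F X] by (simp add: c_def)
        have psd: "moment_psd N w X e" if w: "w \<in> poly_le 2" "0 \<le> w y" for w
          unfolding moment_psd_def
        proof
          fix p :: "real ^ 'n \<Rightarrow> real" assume p: "p \<in> poly_le N"
          have "(\<lambda>x. w x * (p x * p x)) \<in> poly_le M"
            using M(1) by (intro poly_le_mono[OF _ poly_le_mult[OF w(1) poly_le_mult[OF p p]]]) simp
          from e[OF this] show "0 \<le> (\<Sum>x\<in>X. e x * w x * (p x)\<^sup>2)"
            using w(2) by (simp add: power2_eq_square mult.assoc)
        qed
        have zero: "moment_psd N w X (\<lambda>_. 0)" for w by (simp add: moment_psd_def)
        have "C y c"
          unfolding C_def
        proof (intro conjI ballI)
          fix j' assume j': "j' \<in> J"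
          show "moment_psd N (\<lambda>_. 1) X (\<lambda>y. c (j', y))"
            by (cases "j' = j") (simp_all add: cj cn zero psd poly_le_const)
          show "moment_psd N (?b j') X (\<lambda>y. c (j', y))"
            using y(1) by (cases "j' = j") (simp_all add: cj cn zero psd ball_poly_poly_le)
          fix i assume i: "i \<in> I j'"
          show "0 \<le> (\<Sum>y\<in>X. c (j', y) * g j' i y)"
          proof (cases "j' = j")
            case True
            have "g j i \<in> poly_le M" using bspec[OF M(2), of "(j, i)"] i j(1) True by simp
            then show ?thesis using e[of "g j i"] y(2)[of i] i True by (simp add: cj)
          qed (simp add: cn)
        next
          show "- 1 + (\<Sum>k\<in>J \<times> X. c k) = 0"
            using tot[of "\<lambda>_. 1"] e[OF poly_le_const[of 1]] by simp
        next
          fix i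
          have "(\<lambda>x::real^'n. x $ i) \<in> poly_le M"
            using M(1) by (intro poly_le_mono[OF _ poly_le_coord]) simp
          then show "- y $ i + (\<Sum>k\<in>J \<times> X. c k * snd k $ i) = 0"
            using tot[of "\<lambda>x. x $ i"] e[of "\<lambda>x. x $ i"] by simp
        qed
        then show "y \<in> R" unfolding R_def by blast
      qed
    qed
  qed
  ultimately show ?thesis by (simp add: S_def)
qed

section \<open>The convex boundary\<close>

text \<open>It is the projection of a compact set of pairs (point, unit normal of a supporting
  hyperplane). Compactness is what later yields a finite cover.\<close>

lemma compact_convex_boundary:
  fixes T :: "(real ^ 'n) set"
  assumes "compact T"
  shows "compact (convex_boundary T)"
proof -
  let ?K = "(T \<times> sphere (0::real^'n) 1) \<inter> (\<Inter>x\<in>T. {p. snd p \<bullet> fst p \<le> snd p \<bullet> x})"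
  have "compact ?K"
    using assms
    by (intro compact_Int_closed compact_Times compact_sphere closed_INT ballI closed_Collect_le continuous_intros) auto
  moreover have "convex_boundary T = fst ` ?K"
  proof (intro equalityI subsetI)
    fix x assume "x \<in> convex_boundary T"
    then obtain l where "x \<in> T" "norm l = 1" "\<forall>y\<in>T. l \<bullet> x \<le> l \<bullet> y"
      unfolding convex_boundary_def by blast
    then have "(x, l) \<in> ?K" by simp
    then show "x \<in> fst ` ?K" by (rule image_eqI[rotated]) simp
  next
    fix x assume "x \<in> fst ` ?K"
    then obtain p where p: "p \<in> ?K" "x = fst p" by (rule imageE)
    then have "x \<in> T" "norm (snd p) = 1" "\<forall>y\<in>T. snd p \<bullet> x \<le> snd p \<bullet> y" by auto
    then show "x \<in> convex_boundary T" unfolding convex_boundary_def by blast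
  qed
  ultimately show ?thesis
    by (simp only: compact_continuous_image[OF continuous_on_fst[OF continuous_on_id]])
qed

text \<open>Extreme points need not be exposed, but they do lie on a supporting hyperplane, which is
  all that the convex boundary asks for.\<close>

lemma convex_hull_convex_boundary:
  fixes T :: "(real ^ 'n) set"
  assumes "compact T"
  shows "convex hull (convex_boundary T) = convex hull T"
proof
  show "convex hull (convex_boundary T) \<subseteq> convex hull T"
    by (intro hull_mono) (auto simp: convex_boundary_def)
  have "{x. x extreme_point_of (convex hull T)} \<subseteq> convex_boundary T"
  proof
    fix x assume "x \<in> {x. x extreme_point_of (convex hull T)}"
    then have x: "x extreme_point_of (convex hull T)" by simp
    then have xT: "x \<in> T" by (rule extreme_point_of_convex_hull)
    \<comment> \<open>Removing an extreme point keeps the hull convex, so weak separation of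
      \<open>x\<close> from the rest provides the supporting functional.\<close>
    have "convex (convex hull T - {x})"
      using x by (simp add: extreme_point_of_stillconvex)
    then have cv: "convex ((\<lambda>y. y - x) ` (convex hull T - {x}))"
      by (simp add: convex_translation_subtract_eq)
    have z: "0 \<notin> (\<lambda>y. y - x) ` (convex hull T - {x})" by auto
    obtain a where a: "a \<noteq> 0" "\<forall>y\<in>(\<lambda>y. y - x) ` (convex hull T - {x}). 0 \<le> a \<bullet> y"
      using separating_hyperplane_set_0[OF cv z] by (elim exE conjE) (rule that)
    define l where "l = (1 / norm a) *\<^sub>R a"
    have "l \<bullet> x \<le> l \<bullet> y" if "y \<in> T" for y
    proof (cases "y = x")
      case False
      then have "y \<in> convex hull T - {x}" using that by (simp add: hull_inc)
      then have "0 \<le> a \<bullet> (y - x)" by (intro bspec[OF a(2)] imageI)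
      then have "0 \<le> (1 / norm a) * (a \<bullet> (y - x))" by simp
      then show ?thesis by (simp add: l_def inner_diff_right diff_divide_distrib)
    qed simp
    moreover have "norm l = 1" using a(1) by (simp add: l_def)
    ultimately show "x \<in> convex_boundary T" using xT by (auto simp: convex_boundary_def)
  qed
  then have "convex hull {x. x extreme_point_of (convex hull T)} \<subseteq> convex hull (convex_boundary T)"
    by (rule hull_mono)
  then show "convex hull T \<subseteq> convex hull (convex_boundary T)"
    using Krein_Milman_Minkowski[of "convex hull T"] compact_convex_hull[OF assms] by simp
qed

section \<open>Covering the convex boundary by finitely many cells\<close>

theorem theorem4p5:
  fixes T :: "(real ^ 'n) set"
    and L :: nat
    and m :: "nat \<Rightarrow> nat"
    and f :: "nat \<Rightarrow> nat \<Rightarrow> real ^ 'n \<Rightarrow> real"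
  assumes poly: "\<And>k i. k \<in> {1..L} \<Longrightarrow> i \<in> {1..m k} \<Longrightarrow> real_polynomial_function (f k i)"
    and T: "T = (\<Union>k\<in>{1..L}. basic_set (m k) (f k))"
    and compact: "compact T"
    and bd: "\<And>u k i. u \<in> convex_boundary T \<Longrightarrow> k \<in> {1..L} \<Longrightarrow> i \<in> {1..m k} \<Longrightarrow> f k i u = 0 \<Longrightarrow>
      has_interior_near (m k) (f k) u \<and>
      (sos_concave (f k i) \<or> strictly_quasi_concave_at (f k i) u)"
  shows "sdp_representable (convex hull T)"
proof -
  let ?B = "convex_boundary T"
  \<comment> \<open>One radius serves all constraints of all pieces, including pieces that do not
    contain \<open>u\<close>; their points in the ball belong to \<open>T\<close> too.\<close>
  define good where "good u g d \<longleftrightarrow> 0 < d \<and> (\<forall>k\<in>{1..L}. \<forall>i\<in>{1..m k}. real_polynomial_function (g k i) \<and>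
      (\<exists>N. jensen_at N (ball_poly u d) (g k i)) \<and> (\<forall>x\<in>cball u d. 0 \<le> g k i x \<longleftrightarrow> 0 \<le> f k i x))"
    for u d and g :: "nat \<Rightarrow> nat \<Rightarrow> real ^ 'n \<Rightarrow> real"
  have "\<exists>g d. good u g d" if u: "u \<in> ?B" for u
  proof -
    define loc where "loc k i g \<longleftrightarrow> real_polynomial_function g \<and> (\<forall>\<^sub>F d in at_right 0.
        (\<exists>N. jensen_at N (ball_poly u d) g) \<and> (\<forall>x\<in>cball u d. 0 \<le> g x \<longleftrightarrow> 0 \<le> f k i x))" for k i g
    have "\<exists>g. loc k i g" if "k \<in> {1..L}" "i \<in> {1..m k}" for k i
      unfolding loc_def by (rule local_jensen_superlevel[OF poly[OF that]]) (rule bd[OF u that, THEN conjunct2])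
    then have "\<forall>k i. \<exists>g. k \<in> {1..L} \<longrightarrow> i \<in> {1..m k} \<longrightarrow> loc k i g" by blast
    then obtain g where "\<forall>k i. k \<in> {1..L} \<longrightarrow> i \<in> {1..m k} \<longrightarrow> loc k i (g k i)"
      unfolding choice_iff by (elim exE) (rule that)
    then have g: "real_polynomial_function (g k i) \<and>
        (\<forall>\<^sub>F d in at_right 0. (\<exists>N. jensen_at N (ball_poly u d) (g k i)) \<and>
          (\<forall>x\<in>cball u d. 0 \<le> g k i x \<longleftrightarrow> 0 \<le> f k i x))"
      if "k \<in> {1..L}" "i \<in> {1..m k}" for k i
      using that unfolding loc_def by blast
    have "\<forall>\<^sub>F d in at_right 0. \<forall>k\<in>{1..L}. \<forall>i\<in>{1..m k}. (\<exists>N. jensen_at N (ball_poly u d) (g k i)) \<and>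
          (\<forall>x\<in>cball u d. 0 \<le> g k i x \<longleftrightarrow> 0 \<le> f k i x)"
      by (intro eventually_ball_finite finite_atLeastAtMost ballI g[THEN conjunct2])
    then have "\<forall>\<^sub>F d in at_right 0. good u g d"
      using eventually_at_right_less[of "0::real"]
    proof eventually_elim
      case (elim d)
      then show ?case unfolding good_def by (intro conjI ballI) (simp_all add: g)
    qed
    then have "\<exists>d. good u g d" by (rule eventually_happens'[rotated]) simp
    then show ?thesis by blast
  qed
  then have "\<forall>u. \<exists>g d. u \<in> ?B \<longrightarrow> good u g d" by blast
  then obtain g d where "\<forall>u. u \<in> ?B \<longrightarrow> good u (g u) (d u)"
    unfolding choice_iff by (elim exE) (rule that)
  then have good: "good u (g u) (d u)" if "u \<in> ?B" for u using that by blast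
  then have d: "0 < d u" if "u \<in> ?B" for u using that by (simp add: good_def)
  \<comment> \<open>Open balls are needed for the finite subcover; the cells use the closed balls
    with the same radii.\<close>
  obtain U where U: "U \<subseteq> ?B" "finite U" "?B \<subseteq> (\<Union>u\<in>U. ball u (d u))"
  proof (rule compactE_image[OF compact_convex_boundary[OF compact], of ?B "\<lambda>u. ball u (d u)"])
    show "?B \<subseteq> (\<Union>u\<in>?B. ball u (d u))" using d by force
  qed (use that in auto)
  \<comment> \<open>Cells are indexed by pairs of a centre and a piece, because only the
    intersection of a ball with a single piece is cut out by one conjunction of
    inequalities.\<close>
  define cell where "cell j = {x \<in> cball (fst j) (d (fst j)). \<forall>i\<in>{1..m (snd j)}. 0 \<le> g (fst j) (snd j) i x}" for j
  have cell: "cell (u, k) = cball u (d u) \<inter> basic_set (m k) (f k)" if "u \<in> U" "k \<in> {1..L}" for u k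
  proof -
    have "\<forall>i\<in>{1..m k}. \<forall>x\<in>cball u (d u). 0 \<le> g u k i x \<longleftrightarrow> 0 \<le> f k i x"
      using good[of u] U(1) that unfolding good_def by blast
    then show ?thesis unfolding cell_def basic_set_def by auto
  qed
  have "sdp_representable (convex hull (\<Union>j\<in>U \<times> {1..L}. cell j))"
    unfolding cell_def
  proof (rule sdp_representable_hull_cells)
    fix j assume j: "j \<in> U \<times> {1..L}"
    then have G: "good (fst j) (g (fst j)) (d (fst j))" and k: "snd j \<in> {1..L}" using good U(1) by auto
    show "0 \<le> d (fst j)" using G by (simp add: good_def)
    fix i assume i: "i \<in> {1..m (snd j)}"
    show "real_polynomial_function (g (fst j) (snd j) i)"
      "\<exists>N. jensen_at N (ball_poly (fst j) (d (fst j))) (g (fst j) (snd j) i)"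
      using G k i unfolding good_def by blast+
  qed (use U(2) in auto)
  moreover have "convex hull (\<Union>j\<in>U \<times> {1..L}. cell j) = convex hull T"
  proof
    have "(\<Union>j\<in>U \<times> {1..L}. cell j) \<subseteq> T"
      using cell unfolding T by fastforce
    then show "convex hull (\<Union>j\<in>U \<times> {1..L}. cell j) \<subseteq> convex hull T" by (rule hull_mono)
    \<comment> \<open>The cells need not cover \<open>T\<close>: they lie in \<open>T\<close>, and
      containing its convex boundary suffices for equal hulls.\<close>
    have "?B \<subseteq> (\<Union>j\<in>U \<times> {1..L}. cell j)"
    proof
      fix x assume x: "x \<in> ?B"
      then have "x \<in> T" by (simp add: convex_boundary_def)
      then obtain k where k: "k \<in> {1..L}" "x \<in> basic_set (m k) (f k)" unfolding T by blast
      obtain u where u: "u \<in> U" "x \<in> ball u (d u)" using U(3) x by blast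
      have "x \<in> cell (u, k)" unfolding cell[OF u(1) k(1)] using u(2) k(2) by simp
      then show "x \<in> (\<Union>j\<in>U \<times> {1..L}. cell j)" using u(1) k(1) by blast
    qed
    then show "convex hull T \<subseteq> convex hull (\<Union>j\<in>U \<times> {1..L}. cell j)"
      unfolding convex_hull_convex_boundary[OF compact, symmetric] by (rule hull_mono)
  qed
  ultimately show ?thesis by simp
qed

end
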